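(* Let $K\subset\mathbb R^2$ be a continuum. Then the outer Minkowski content of $K$ exists and $$\mathcal{SM}(K)=\sup_{\epsilon>0}\bigg[\frac{\mathcal L(K^{\oplus\epsilon}\setminus K)}{\epsilon}-\pi\epsilon\bigg].$$
   Context: A continuum is a compact, connected, non-empty set. For a closed set $K\subset\mathbb R^2$ and $\epsilon>0$ let $K^{\oplus\epsilon}=\{x\in\mathbb R^2: \mathrm d_K(x)\le\epsilon\}$, where $\mathrm d_K$ is the distance function to $K$, and let $\mathcal L$ be the Lebesgue measure on $\mathbb R^2$. Set $\mathcal{SM}_*(K)=\liminf_{\epsilon\to0^+}\mathcal L(K^{\oplus\epsilon}\setminus K)/\epsilon$ and $\mathcal{SM}^*(K)=\limsup_{\epsilon\to0^+}\mathcal L(K^{\oplus\epsilon}\setminus K)/\epsilon$, both in $[0,+\infty]$. If $\mathcal{SM}_*(K)=\mathcal{SM}^*(K)$, the common value (possibly $+\infty$) is denoted $\mathcal{SM}(K)$ and called the outer Minkowski content of $K$; one then says that it exists. *)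

theory Defs
  imports "HOL-Analysis.Analysis"
begin

definition continuum :: "'a::topological_space set \<Rightarrow> bool" where
  "continuum K \<longleftrightarrow> compact K \<and> connected K \<and> K \<noteq> {}"

(* Intended for nonempty K only, since infdist x {} = 0. *)
definition parallel_set :: "(real^2) set \<Rightarrow> real \<Rightarrow> (real^2) set" where
  "parallel_set K \<epsilon> = {x. infdist x K \<le> \<epsilon>}"

definition outer_minkowski_quotient :: "(real^2) set \<Rightarrow> real \<Rightarrow> ereal" where
  "outer_minkowski_quotient K \<epsilon> =
     enn2ereal (emeasure lebesgue (parallel_set K \<epsilon> - K)) / ereal \<epsilon>"

definition lower_outer_minkowski_content :: "(real^2) set \<Rightarrow> ereal" where
  "lower_outer_minkowski_content K = Liminf (at_right 0) (outer_minkowski_quotient K)"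

definition upper_outer_minkowski_content :: "(real^2) set \<Rightarrow> ereal" where
  "upper_outer_minkowski_content K = Limsup (at_right 0) (outer_minkowski_quotient K)"

definition outer_minkowski_content_exists :: "(real^2) set \<Rightarrow> bool" where
  "outer_minkowski_content_exists K \<longleftrightarrow>
     lower_outer_minkowski_content K = upper_outer_minkowski_content K"

(* Unspecified when the lower and upper contents differ. *)
definition outer_minkowski_content :: "(real^2) set \<Rightarrow> ereal" where
  "outer_minkowski_content K =
     (THE c. lower_outer_minkowski_content K = c \<and> upper_outer_minkowski_content K = c)"

end

theory Submission
  imports Defs
begin

text \<open>
  Write \<open>|X|\<close> for area and \<open>B\<close> for the closed unit disc, so that the parallel set is \<open>K + \<epsilon>B\<close>.
  For a compact connected planar set \<open>M\<close> and segments \<open>P = [0,u]\<close>, \<open>Q = [0,v]\<close> one has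
  \<open>|M + P + Q| - |M + P| - |M + Q| + |M| \<le> |det(u,v)|\<close>: replacing \<open>M\<close> by the cells of a fine lattice
  spanned by multiples of \<open>u\<close> and \<open>v\<close>, this is the fact that a connected union of cells has Euler
  characteristic at most 1. The left-hand side is additive in \<open>P\<close> and \<open>Q\<close> up to replacing \<open>M\<close> by a larger
  connected set, so the bound extends to sums of segments, and in the limit of regular polygons to
  \<open>|M + 2sB| - 2|M + sB| + |M| \<le> 2\<pi>s\<^sup>2\<close>. Hence \<open>V(\<epsilon>) = |K + \<epsilon>B| - |K|\<close> satisfies
  \<open>V(ns)/(ns) - \<pi>ns \<le> V(s)/s - \<pi>s\<close> for every natural number \<open>n\<close>. Choosing \<open>n = \<lceil>r/s\<rceil>\<close> and letting
  \<open>s\<close> tend to 0 bounds the lower content from below by \<open>V(r)/r - \<pi>r\<close> for every \<open>r\<close>.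
\<close>

section \<open>Euler characteristic of grid sets\<close>

text \<open>Indices are lower left corners of closed unit squares; adjacency means that the squares
  meet, possibly only in a corner. Every index is adjacent to itself.\<close>

definition grid_adjacent :: "int \<times> int \<Rightarrow> int \<times> int \<Rightarrow> bool" where
  "grid_adjacent p q \<longleftrightarrow> \<bar>fst p - fst q\<bar> \<le> 1 \<and> \<bar>snd p - snd q\<bar> \<le> 1"

text \<open>The two parts may overlap: a common index is adjacent to itself, so only disjoint
  splittings impose a condition. This is connectedness of the union of the closed squares.\<close>

definition grid_connected :: "(int \<times> int) set \<Rightarrow> bool" where
  "grid_connected S \<longleftrightarrow>
     (\<forall>A B. S = A \<union> B \<and> A \<noteq> {} \<and> B \<noteq> {} \<longrightarrow> (\<exists>a\<in>A. \<exists>b\<in>B. grid_adjacent a b))"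

text \<open>Discrete counterpart of adding a segment along the first lattice direction;
  \<open>lattice_cells_widen\<close> makes this exact.\<close>

definition widen :: "(int \<times> int) set \<Rightarrow> (int \<times> int) set" where
  "widen S = S \<union> (\<lambda>(x, y). (x + 1, y)) ` S"

definition heighten :: "(int \<times> int) set \<Rightarrow> (int \<times> int) set" where
  "heighten S = S \<union> (\<lambda>(x, y). (x, y + 1)) ` S"

lemma mem_widen: "(x, y) \<in> widen S \<longleftrightarrow> (x, y) \<in> S \<or> (x - 1, y) \<in> S"
  by (auto simp: widen_def intro!: image_eqI[where x = "(x - 1, y)"])

lemma mem_heighten: "(x, y) \<in> heighten S \<longleftrightarrow> (x, y) \<in> S \<or> (x, y - 1) \<in> S"
  by (auto simp: heighten_def intro!: image_eqI[where x = "(x, y - 1)"])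

lemma finite_widen [simp]: "finite S \<Longrightarrow> finite (widen S)"
  by (simp add: widen_def)

lemma finite_heighten [simp]: "finite S \<Longrightarrow> finite (heighten S)"
  by (simp add: heighten_def)

lemma widen_heighten: "widen (heighten S) = heighten (widen S)"
  by (auto simp: mem_widen mem_heighten)

text \<open>
  Read \<^term>\<open>S\<close> as a set of closed unit squares. Indexing vertices and edges by lower left corners,
  \<^term>\<open>widen S\<close>, \<^term>\<open>heighten S\<close> and \<^term>\<open>widen (heighten S)\<close> are the vertical edges, horizontal
  edges and vertices of their union, so the lemma says that the Euler characteristic is at most the
  number of components. Squares are added in the order of \<open>x + 2 * y\<close>, so that a new square only meets
  its neighbours W, SW, S, SE and never closes up a hole.
\<close>

lemma grid_euler_components:
  assumes "finite S"
  shows "\<exists>C. finite C \<and> \<Union>C = S \<and> {} \<notin> C \<and>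
    (\<forall>A\<in>C. \<forall>B\<in>C. A \<noteq> B \<longrightarrow> (\<forall>a\<in>A. \<forall>b\<in>B. \<not> grid_adjacent a b)) \<and>
    card (widen (heighten S)) + card S \<le> card (widen S) + card (heighten S) + card C"
  using assms
proof (induction S rule: finite_ranking_induct[where f = "\<lambda>(x, y). x + 2 * y"])
  case empty
  show ?case by (intro exI[of _ "{}"]) (simp add: widen_def heighten_def)
next
  case (insert p S)
  obtain x y where p: "p = (x, y)" by fastforce
  show ?case
  proof (cases "p \<in> S")
    case True
    then show ?thesis using insert by (simp add: insert_absorb)
  next
    case False
    obtain C where C: "finite C" "\<Union>C = S" "{} \<notin> C"
        "card (widen (heighten S)) + card S \<le> card (widen S) + card (heighten S) + card C"
      and sep: "\<forall>A\<in>C. \<forall>B\<in>C. A \<noteq> B \<longrightarrow> (\<forall>a\<in>A. \<forall>b\<in>B. \<not> grid_adjacent a b)"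
      using insert.IH by (elim exE conjE) (rule that)
    have sep: "A = B" if "A \<in> C" "B \<in> C" "a \<in> A" "b \<in> B" "grid_adjacent a b" for A B a b
      using sep that by blast
    \<comment> \<open>\<open>N\<close> collects the old components touched by the new square;
      \<open>D\<close> merges them with it into one.\<close>
    define N where "N = {A \<in> C. \<exists>a\<in>A. grid_adjacent a p}"
    define D where "D = insert (insert p (\<Union>N)) (C - N)"
    have ranked: "a + 2 * b \<le> x + 2 * y" if "(a, b) \<in> S" for a b
      using insert.hyps(2)[OF that] by (simp add: p)
    have notin: "(x, y) \<notin> S" "(x + 1, y) \<notin> S" "(x - 1, y + 1) \<notin> S" "(x, y + 1) \<notin> S" "(x + 1, y + 1) \<notin> S"
      using False p by (auto dest: ranked)
    let ?W = "(x - 1, y) \<in> S" and ?SW = "(x - 1, y - 1) \<in> S"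
    let ?S = "(x, y - 1) \<in> S" and ?SE = "(x + 1, y - 1) \<in> S"
    have w: "widen (insert p S) = insert p (insert (x + 1, y) (widen S))"
      by (auto simp: mem_widen p)
    have h: "heighten (insert p S) = insert p (insert (x, y + 1) (heighten S))"
      by (auto simp: mem_heighten p)
    have v: "widen (heighten (insert p S)) =
        insert p (insert (x + 1, y) (insert (x, y + 1) (insert (x + 1, y + 1) (widen (heighten S)))))"
      by (auto simp: mem_widen mem_heighten p)
    \<comment> \<open>Count the edges and vertices of the new square that are already present. The
      left edge is shared with W and the bottom edge with S; the lower left vertex is shared with W,
      S, SW, the lower right with S, SE, and the upper left with W. The other two edges and the
      upper right vertex are new.\<close>
    have card_w: "card (widen (insert p S)) + of_bool ?W = card (widen S) + 2"
      using insert.hyps(1) notin unfolding w by (auto simp: card_insert_if mem_widen p)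
    have card_h: "card (heighten (insert p S)) + of_bool ?S = card (heighten S) + 2"
      using insert.hyps(1) notin unfolding h by (auto simp: card_insert_if mem_heighten p)
    have card_v: "card (widen (heighten (insert p S))) + of_bool (?W \<or> ?S \<or> ?SW)
        + of_bool (?SE \<or> ?S) + of_bool ?W = card (widen (heighten S)) + 4"
      using insert.hyps(1) notin unfolding v by (auto simp: card_insert_if mem_widen mem_heighten p)
    have N_sub: "N \<subseteq> C" and finN: "finite N"
      using C(1) by (auto simp: N_def)
    have neighbour: "(?W \<and> (x - 1, y) \<in> A) \<or> (?SW \<and> (x - 1, y - 1) \<in> A) \<or> (?S \<and> (x, y - 1) \<in> A) \<or> (?SE \<and> (x + 1, y - 1) \<in> A)"
      if A: "A \<in> N" for A
    proof -
      obtain a b where ab: "(a, b) \<in> A" "grid_adjacent (a, b) p" using A by (auto simp: N_def)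
      then have "(a, b) \<in> S" using A C(2) by (auto simp: N_def)
      moreover have "a \<in> {x - 1, x, x + 1}" "b \<in> {y - 1, y, y + 1}"
        using ab(2) by (auto simp: grid_adjacent_def p)
      ultimately show ?thesis using ab(1) notin by auto
    qed
    have same: "A = B" if "A \<in> N" "B \<in> N" "a \<in> A" "b \<in> B" "grid_adjacent a b" for A B a b
      using sep N_sub that by blast
    \<comment> \<open>W, SW and S meet in the lower left vertex, S and SE in the lower right one.
      The squares around one vertex are mutually adjacent, so each of \<open>N1\<close>,
      \<open>N2\<close> has at most one member.\<close>
    define N1 where "N1 = {A \<in> N. (x - 1, y) \<in> A \<or> (x - 1, y - 1) \<in> A \<or> (x, y - 1) \<in> A}"
    define N2 where "N2 = {A \<in> N. (x + 1, y - 1) \<in> A \<or> (x, y - 1) \<in> A}"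
    have N12: "N = N1 \<union> N2" using neighbour by (auto simp: N1_def N2_def)
    have c1: "card N1 \<le> of_bool (?W \<or> ?S \<or> ?SW)"
    proof (cases "N1 = {}")
      case False
      then obtain A where A: "A \<in> N1" by blast
      have "N1 \<subseteq> {A}"
      proof
        fix B assume B: "B \<in> N1"
        obtain a b where ab: "a \<in> A" "b \<in> B"
            "a \<in> {(x - 1, y), (x - 1, y - 1), (x, y - 1)}" "b \<in> {(x - 1, y), (x - 1, y - 1), (x, y - 1)}"
          using A B unfolding N1_def by blast
        then have "grid_adjacent a b" by (auto simp: grid_adjacent_def)
        then have "A = B" using same ab A B by (simp add: N1_def)
        then show "B \<in> {A}" by simp
      qed
      then have "card N1 \<le> 1" using card_mono[of "{A}" N1] by simp
      moreover have "?W \<or> ?S \<or> ?SW" using A C(2) N_sub by (auto simp: N1_def)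
      ultimately show ?thesis by simp
    qed simp
    have c2: "card N2 \<le> of_bool (?SE \<or> ?S)"
    proof (cases "N2 = {}")
      case False
      then obtain A where A: "A \<in> N2" by blast
      have "N2 \<subseteq> {A}"
      proof
        fix B assume B: "B \<in> N2"
        obtain a b where ab: "a \<in> A" "b \<in> B"
            "a \<in> {(x + 1, y - 1), (x, y - 1)}" "b \<in> {(x + 1, y - 1), (x, y - 1)}"
          using A B unfolding N2_def by blast
        then have "grid_adjacent a b" by (auto simp: grid_adjacent_def)
        then have "A = B" using same ab A B by (simp add: N2_def)
        then show "B \<in> {A}" by simp
      qed
      then have "card N2 \<le> 1" using card_mono[of "{A}" N2] by simp
      moreover have "?S \<or> ?SE" using A C(2) N_sub by (auto simp: N2_def)
      ultimately show ?thesis by auto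
    qed simp
    \<comment> \<open>If S is present, its component is counted in both \<open>N1\<close> and
      \<open>N2\<close>. This double count balances the shared bottom edge; the shared left edge is
      balanced by the upper left vertex.\<close>
    have c12: "of_bool ?S \<le> card (N1 \<inter> N2)"
    proof (cases ?S)
      case True
      then obtain A where A: "A \<in> C" "(x, y - 1) \<in> A" using C(2) by blast
      moreover have "grid_adjacent (x, y - 1) p" by (simp add: grid_adjacent_def p)
      ultimately have "A \<in> N" unfolding N_def by blast
      then have "N1 \<inter> N2 \<noteq> {}" using A by (auto simp: N1_def N2_def)
      moreover have "finite (N1 \<inter> N2)" using finN N12 by simp
      ultimately show ?thesis using True by (simp add: card_gt_0_iff Suc_le_eq)
    qed simp
    have card_N: "card N + of_bool ?S \<le> of_bool (?W \<or> ?S \<or> ?SW) + of_bool (?SE \<or> ?S)"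
    proof -
      have "card N1 + card N2 = card N + card (N1 \<inter> N2)"
        using card_Un_Int[of N1 N2] finN N12 by simp
      then show ?thesis using c1 c2 c12 by linarith
    qed
    have "insert p (\<Union>N) \<notin> C - N" using C(2) False by auto
    then have card_D: "card D + card N = card C + 1"
      unfolding D_def using C(1) N_sub finN card_mono[OF C(1) N_sub]
      by (simp add: card_Diff_subset)
    have "finite D" "\<Union>D = insert p S" "{} \<notin> D"
      using C N_sub by (auto simp: D_def)
    moreover have "A = B" if AB: "A \<in> D" "B \<in> D" and ab: "a \<in> A" "b \<in> B" "grid_adjacent a b" for A B a b
    proof -
      have ba: "grid_adjacent b a" using ab(3) by (auto simp: grid_adjacent_def)
      have *: False if X: "X \<in> C - N" "c \<in> X" "d \<in> insert p (\<Union>N)" "grid_adjacent c d" for X c d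
      proof (cases "d = p")
        case True
        then show False using X by (auto simp: N_def)
      next
        case False
        then obtain Y where "Y \<in> N" "d \<in> Y" using X by blast
        then show False using X sep[of X Y c d] N_sub by blast
      qed
      consider "A \<in> C - N" "B \<in> C - N" | "A \<in> C - N" "B = insert p (\<Union>N)"
        | "A = insert p (\<Union>N)" "B \<in> C - N" | "A = insert p (\<Union>N)" "B = insert p (\<Union>N)"
        using AB unfolding D_def by blast
      then show ?thesis
      proof cases
        case 1
        then show ?thesis using sep ab by blast
      next
        case 2
        then show ?thesis using *[of A a b] ab by blast
      next
        case 3
        then show ?thesis using *[of B b a] ab ba by blast
      qed simp
    qed
    moreover have "card (widen (heighten (insert p S))) + card (insert p S)
        \<le> card (widen (insert p S)) + card (heighten (insert p S)) + card D"
      using card_w card_h card_v card_N card_D C(4) card_insert_disjoint[OF insert.hyps(1) False]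
      by linarith
    ultimately show ?thesis by (intro exI[of _ D]) blast
  qed
qed

text \<open>Distinct members of the decomposition are never adjacent, so by connectedness there is
  at most one of them.\<close>

lemma grid_euler_connected:
  assumes "finite S" "grid_connected S"
  shows "card (widen (heighten S)) + card S \<le> card (widen S) + card (heighten S) + 1"
proof -
  obtain C where C: "finite C" "\<Union>C = S" "{} \<notin> C"
    "\<And>A B a b. A \<in> C \<Longrightarrow> B \<in> C \<Longrightarrow> A \<noteq> B \<Longrightarrow> a \<in> A \<Longrightarrow> b \<in> B \<Longrightarrow> \<not> grid_adjacent a b"
    "card (widen (heighten S)) + card S \<le> card (widen S) + card (heighten S) + card C"
    using grid_euler_components[OF assms(1)] by metis
  have "A = B" if AB: "A \<in> C" "B \<in> C" for A B
  proof (rule ccontr)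
    assume ne: "A \<noteq> B"
    have "S = A \<union> \<Union>(C - {A})" using C(2) AB by blast
    moreover have "A \<noteq> {}" "B \<noteq> {}" using AB C(3) by metis+
    then have "A \<noteq> {}" "\<Union>(C - {A}) \<noteq> {}" using AB(2) ne by blast+
    ultimately obtain a b where "a \<in> A" "b \<in> \<Union>(C - {A})" "grid_adjacent a b"
      using assms(2) unfolding grid_connected_def by blast
    then show False using C(4) AB by blast
  qed
  then have "card C \<le> 1" using C(1) by (metis One_nat_def card_le_Suc0_iff_eq)
  then show ?thesis using C(5) by linarith
qed

text \<open>A splitting of the union restricts to \<open>S\<close>. If one part misses
  \<open>S\<close>, each of its points lies in \<open>T\<close> and has a neighbour in
  \<open>S\<close>, hence in the other part.\<close>

lemma grid_connected_Un_adjacent: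
  assumes "grid_connected S" and "\<And>t. t \<in> T \<Longrightarrow> \<exists>s\<in>S. grid_adjacent s t"
  shows "grid_connected (S \<union> T)"
  unfolding grid_connected_def
proof (intro allI impI, elim conjE)
  fix A B assume AB: "S \<union> T = A \<union> B" "A \<noteq> {}" "B \<noteq> {}"
  have sym: "grid_adjacent b a" if "grid_adjacent a b" for a b
    using that by (auto simp: grid_adjacent_def)
  have "S = (S \<inter> A) \<union> (S \<inter> B)" using AB(1) by blast
  then consider "S \<inter> A = {}" | "S \<inter> B = {}" | "\<exists>a\<in>S \<inter> A. \<exists>b\<in>S \<inter> B. grid_adjacent a b"
    using assms(1) unfolding grid_connected_def by meson
  then show "\<exists>a\<in>A. \<exists>b\<in>B. grid_adjacent a b"
  proof cases
    case 1
    obtain a where "a \<in> A" using AB by blast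
    then obtain s where "s \<in> S" "grid_adjacent s a" using 1 AB(1) assms(2) by blast
    then show ?thesis using 1 AB(1) \<open>a \<in> A\<close> sym by blast
  next
    case 2
    obtain b where "b \<in> B" using AB by blast
    then obtain s where "s \<in> S" "grid_adjacent s b" using 2 AB(1) assms(2) by blast
    then show ?thesis using 2 AB(1) \<open>b \<in> B\<close> by blast
  qed blast
qed

lemma grid_connected_widen: "grid_connected S \<Longrightarrow> grid_connected (widen S)"
  unfolding widen_def
  by (rule grid_connected_Un_adjacent) (force simp: grid_adjacent_def)+

lemma grid_connected_heighten: "grid_connected S \<Longrightarrow> grid_connected (heighten S)"
  unfolding heighten_def
  by (rule grid_connected_Un_adjacent) (force simp: grid_adjacent_def)+

lemma widen_funpow_heighten: "widen ((heighten ^^ n) S) = (heighten ^^ n) (widen S)"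
  by (induction n) (simp_all add: widen_heighten)

text \<open>The \<open>m * n\<close> unit inequalities telescope: first over the heightenings of a
  fixed set, then over the widenings of \<open>S\<close>. All intermediate sets stay
  connected.\<close>

lemma grid_euler_iterated:
  assumes "finite S" "grid_connected S"
  shows "card ((widen ^^ m) ((heighten ^^ n) S)) + card S
    \<le> card ((widen ^^ m) S) + card ((heighten ^^ n) S) + m * n"
proof -
  have one: "card (widen ((heighten ^^ n) S)) + card S \<le> card (widen S) + card ((heighten ^^ n) S) + n"
    if "finite S" "grid_connected S" for S
  proof (induction n)
    case (Suc n)
    have "finite ((heighten ^^ n) S) \<and> grid_connected ((heighten ^^ n) S)"
      using that by (induction n) (simp_all add: grid_connected_heighten)
    from grid_euler_connected[OF this[THEN conjunct1] this[THEN conjunct2]] Suc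
    show ?case by simp
  qed simp
  show ?thesis
  proof (induction m)
    case (Suc m)
    have "finite ((widen ^^ m) S) \<and> grid_connected ((widen ^^ m) S)"
      using assms by (induction m) (simp_all add: grid_connected_widen)
    moreover have "(widen ^^ m) ((heighten ^^ n) S) = (heighten ^^ n) ((widen ^^ m) S)"
      by (induction m) (simp_all add: widen_funpow_heighten)
    ultimately show ?case using one[of "(widen ^^ m) S"] Suc by simp
  qed simp
qed

section \<open>Minkowski sums and lattice cells\<close>

lemma compact_set_plus:
  fixes A B :: "'a::real_normed_vector set"
  shows "compact A \<Longrightarrow> compact B \<Longrightarrow> compact (A + B)"
  using compact_sums[of A B] by (simp add: set_plus_def Bex_def conj_ac)

lemma connected_set_plus:
  fixes A B :: "'a::real_normed_vector set"
  assumes "connected A" "connected B"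
  shows "connected (A + B)"
  unfolding set_plus_image split_def
  by (intro connected_continuous_image continuous_intros connected_Times assms)

lemma set_plus_cball: "A + cball 0 d = (\<Union>x\<in>A. cball x d)" for A :: "'a::real_normed_vector set"
proof (intro equalityI subsetI)
  fix z assume "z \<in> (\<Union>x\<in>A. cball x d)"
  then obtain x where x: "x \<in> A" "dist x z \<le> d" by auto
  then have "x + (z - x) \<in> A + cball 0 d"
    by (intro set_plus_intro) (auto simp: dist_norm norm_minus_commute)
  then show "z \<in> A + cball 0 d" by simp
qed (force simp: set_plus_def dist_norm)

lemma measure_mono_compact:
  fixes A B :: "'a::euclidean_space set"
  shows "A \<subseteq> B \<Longrightarrow> A \<in> sets lebesgue \<Longrightarrow> compact B \<Longrightarrow> measure lebesgue A \<le> measure lebesgue B"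
  using measure_mono_fmeasurable lmeasurable_compact by blast

text \<open>Outer regularity encloses \<open>X\<close> in an open set of nearly the same area, and
  by compactness this open set contains all sufficiently thin thickenings. Errors given by small
  balls can therefore be removed in the limit.\<close>

lemma tendsto_measure_parallel:
  fixes X :: "'a::euclidean_space set"
  assumes "compact X"
  shows "((\<lambda>d. measure lebesgue (X + cball 0 d)) \<longlongrightarrow> measure lebesgue X) (at_right 0)"
proof (rule tendstoI)
  fix e :: real assume e: "e > 0"
  obtain T where T: "open T" "X \<subseteq> T" "T - X \<in> lmeasurable" "emeasure lebesgue (T - X) < ennreal e"
    using sets_lebesgue_outer_open[OF _ e, of X] assms lmeasurable_compact fmeasurableD by blast
  have meas: "measure lebesgue (T - X) < e"
    using T(3,4) e by (simp add: emeasure_eq_measure2 ennreal_less_iff)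
  have TX: "T = X \<union> (T - X)" using T(2) by blast
  have Tm: "T \<in> lmeasurable"
    using TX T(3) lmeasurable_compact[OF assms] fmeasurable.Un by metis
  have Tless: "measure lebesgue T < measure lebesgue X + e"
    using measure_Un_le[of X lebesgue "T - X"] TX meas T(3) lmeasurable_compact[OF assms]
    by (metis add_strict_left_mono fmeasurableD le_less_trans)
  obtain d where d: "d > 0" "(\<Union>x\<in>X. cball x d) \<subseteq> T"
    using compact_subset_open_imp_cball_epsilon_subset[OF assms T(1,2)] .
  have "dist (measure lebesgue (X + cball 0 r)) (measure lebesgue X) < e" if r: "0 < r" "r < d" for r
  proof -
    have c: "compact (X + cball 0 r)" by (intro compact_set_plus assms compact_cball)
    have "X + cball 0 r \<subseteq> T"
      using d(2) r unfolding set_plus_cball by (meson SUP_mono' less_imp_le order_trans subset_cball)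
    then have "measure lebesgue (X + cball 0 r) \<le> measure lebesgue T"
      using measure_mono_fmeasurable[OF _ _ Tm] lmeasurable_compact[OF c] by blast
    moreover have "X \<subseteq> X + cball 0 r" using r unfolding set_plus_cball by force
    then have "measure lebesgue X \<le> measure lebesgue (X + cball 0 r)"
      using measure_mono_compact[OF _ _ c] lmeasurable_compact[OF assms] by blast
    ultimately show ?thesis using Tless by (simp add: dist_real_def)
  qed
  then show "\<forall>\<^sub>F r in at_right 0. dist (measure lebesgue (X + cball 0 r)) (measure lebesgue X) < e"
    using d(1) unfolding eventually_at_right_field by blast
qed

section \<open>Cells of a planar lattice\<close>

definition cross2 :: "real^2 \<Rightarrow> real^2 \<Rightarrow> real" where
  "cross2 u v = u$1 * v$2 - u$2 * v$1"

text \<open>The floors make the cells half-open. For independent \<open>p\<close>, \<open>q\<close>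
  distinct cells are then disjoint and area is an exact count, while adding a closed lattice segment
  still produces a union of whole cells.\<close>

definition lattice_cells :: "real^2 \<Rightarrow> real^2 \<Rightarrow> (int \<times> int) set \<Rightarrow> (real^2) set" where
  "lattice_cells p q S = {a *\<^sub>R p + b *\<^sub>R q | a b. (\<lfloor>a\<rfloor>, \<lfloor>b\<rfloor>) \<in> S}"

text \<open>Cramer's rule for the basis \<open>p\<close>, \<open>q\<close>.\<close>

lemma cross2_coords:
  assumes "cross2 p q \<noteq> 0"
  shows "z = (cross2 z q / cross2 p q) *\<^sub>R p + (cross2 p z / cross2 p q) *\<^sub>R q"
proof -
  have "cross2 p q *\<^sub>R z = cross2 z q *\<^sub>R p + cross2 p z *\<^sub>R q"
    by (simp add: vec_eq_iff forall_2 cross2_def algebra_simps)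
  then have "z = inverse (cross2 p q) *\<^sub>R (cross2 z q *\<^sub>R p + cross2 p z *\<^sub>R q)"
    using assms by (metis inverse_inverse_eq scaleR_left_imp_eq scaleR_one scaleR_scaleR left_inverse)
  then show ?thesis by (simp add: scaleR_right_distrib field_simps)
qed

lemma cross2_coords_unique:
  assumes "cross2 p q \<noteq> 0" "z = a *\<^sub>R p + b *\<^sub>R q"
  shows "a = cross2 z q / cross2 p q" "b = cross2 p z / cross2 p q"
proof -
  have "cross2 z q = a * cross2 p q" "cross2 p z = b * cross2 p q"
    using assms(2) by (auto simp: cross2_def algebra_simps)
  then show "a = cross2 z q / cross2 p q" "b = cross2 p z / cross2 p q"
    using assms(1) by auto
qed

lemma closed_segment_0_add:
  fixes p :: "'a::real_normed_vector"
  assumes "a \<ge> 0" "b \<ge> 0"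
  shows "closed_segment 0 (a *\<^sub>R p) + closed_segment 0 (b *\<^sub>R p) = closed_segment 0 ((a + b) *\<^sub>R p)"
proof (intro equalityI subsetI)
  fix z assume "z \<in> closed_segment 0 (a *\<^sub>R p) + closed_segment 0 (b *\<^sub>R p)"
  then obtain s t where st: "0 \<le> s" "s \<le> 1" "0 \<le> t" "t \<le> 1" and z: "z = s *\<^sub>R a *\<^sub>R p + t *\<^sub>R b *\<^sub>R p"
    by (auto simp: set_plus_def closed_segment_def)
  show "z \<in> closed_segment 0 ((a + b) *\<^sub>R p)"
  proof (cases "a + b = 0")
    case True
    then show ?thesis using assms z by (simp add: add_nonneg_eq_0_iff)
  next
    case False
    have "s * a + t * b \<le> a + b" using st assms by (intro add_mono mult_left_le_one_le) auto
    moreover have "z = (s * a + t * b) *\<^sub>R p" by (simp add: z scaleR_left_distrib)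
    then have "z = ((s * a + t * b) / (a + b)) *\<^sub>R (a + b) *\<^sub>R p"
      using False by simp
    ultimately show ?thesis using st assms False unfolding closed_segment_def
      by (auto intro!: exI[of _ "(s * a + t * b) / (a + b)"] simp: divide_le_eq)
  qed
next
  fix z assume "z \<in> closed_segment 0 ((a + b) *\<^sub>R p)"
  then obtain t where t: "0 \<le> t" "t \<le> 1" and z: "z = t *\<^sub>R (a + b) *\<^sub>R p"
    by (auto simp: closed_segment_def)
  have "t *\<^sub>R a *\<^sub>R p + t *\<^sub>R b *\<^sub>R p \<in> closed_segment 0 (a *\<^sub>R p) + closed_segment 0 (b *\<^sub>R p)"
    using t by (intro set_plus_intro) (auto simp: closed_segment_def)
  then show "z \<in> closed_segment 0 (a *\<^sub>R p) + closed_segment 0 (b *\<^sub>R p)"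
    using z by (simp add: algebra_simps)
qed

text \<open>Equality is exact because a half-open unit interval plus the closed interval [0,1] is
  the half-open interval of length 2, that is, two neighbouring cells.\<close>

lemma lattice_cells_widen: "lattice_cells p q (widen S) = lattice_cells p q S + closed_segment 0 p"
proof (intro equalityI subsetI)
  fix z assume "z \<in> lattice_cells p q (widen S)"
  then obtain a b where z: "z = a *\<^sub>R p + b *\<^sub>R q" and ab: "(\<lfloor>a\<rfloor>, \<lfloor>b\<rfloor>) \<in> S \<or> (\<lfloor>a - 1\<rfloor>, \<lfloor>b\<rfloor>) \<in> S"
    by (auto simp: lattice_cells_def mem_widen)
  define t :: real where "t = (if (\<lfloor>a\<rfloor>, \<lfloor>b\<rfloor>) \<in> S then 0 else 1)"
  have "(a - t) *\<^sub>R p + b *\<^sub>R q \<in> lattice_cells p q S"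
  proof -
    have "(\<lfloor>a - t\<rfloor>, \<lfloor>b\<rfloor>) \<in> S" using ab by (auto simp: t_def)
    then show ?thesis unfolding lattice_cells_def by blast
  qed
  moreover have "t *\<^sub>R p \<in> closed_segment 0 p" by (auto simp: closed_segment_def t_def)
  ultimately have "((a - t) *\<^sub>R p + b *\<^sub>R q) + t *\<^sub>R p \<in> lattice_cells p q S + closed_segment 0 p"
    by (rule set_plus_intro)
  then show "z \<in> lattice_cells p q S + closed_segment 0 p" by (simp add: z algebra_simps)
next
  fix z assume "z \<in> lattice_cells p q S + closed_segment 0 p"
  then obtain a b t where z: "z = (a *\<^sub>R p + b *\<^sub>R q) + t *\<^sub>R p" and ab: "(\<lfloor>a\<rfloor>, \<lfloor>b\<rfloor>) \<in> S" and t: "0 \<le> t" "t \<le> 1"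
    by (auto simp: lattice_cells_def closed_segment_def elim!: set_plus_elim)
  have "\<lfloor>a + t\<rfloor> = \<lfloor>a\<rfloor> \<or> \<lfloor>a + t\<rfloor> = \<lfloor>a\<rfloor> + 1" using t by linarith
  then have "(\<lfloor>a + t\<rfloor>, \<lfloor>b\<rfloor>) \<in> widen S" using ab by (auto simp: mem_widen)
  moreover have "z = (a + t) *\<^sub>R p + b *\<^sub>R q" by (simp add: z algebra_simps)
  ultimately show "z \<in> lattice_cells p q (widen S)" unfolding lattice_cells_def by blast
qed

text \<open>Interchanging the two lattice directions turns \<open>heighten\<close> into
  \<open>widen\<close>.\<close>

lemma lattice_cells_heighten: "lattice_cells p q (heighten S) = lattice_cells p q S + closed_segment 0 q"
proof -
  have sub: "lattice_cells p q T \<subseteq> lattice_cells q p (prod.swap ` T)" for p q T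
  proof
    fix z assume "z \<in> lattice_cells p q T"
    then obtain a b where "z = b *\<^sub>R q + a *\<^sub>R p" "(\<lfloor>a\<rfloor>, \<lfloor>b\<rfloor>) \<in> T"
      unfolding lattice_cells_def using add.commute by blast
    then show "z \<in> lattice_cells q p (prod.swap ` T)"
      unfolding lattice_cells_def by force
  qed
  have "prod.swap ` prod.swap ` T = T" for T :: "(int \<times> int) set" by (simp add: image_image)
  then have swap: "lattice_cells p q T = lattice_cells q p (prod.swap ` T)" for p q T
    using sub[of p q T] sub[of q p "prod.swap ` T"] by auto
  have "prod.swap ` heighten S = widen (prod.swap ` S)"
    by (force simp: heighten_def widen_def image_Un image_image)
  then show ?thesis using swap lattice_cells_widen by metis
qed

lemma lattice_cells_widen_funpow:
  "lattice_cells p q ((widen ^^ n) S) = lattice_cells p q S + closed_segment 0 (real n *\<^sub>R p)"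
proof (induction n)
  case (Suc n)
  have "closed_segment 0 (real n *\<^sub>R p) + closed_segment 0 p = closed_segment 0 (real (Suc n) *\<^sub>R p)"
    using closed_segment_0_add[of "real n" 1 p] by (simp add: add.commute)
  then show ?case using Suc by (simp add: lattice_cells_widen add.assoc)
qed simp

lemma lattice_cells_heighten_funpow:
  "lattice_cells p q ((heighten ^^ n) S) = lattice_cells p q S + closed_segment 0 (real n *\<^sub>R q)"
proof (induction n)
  case (Suc n)
  have "closed_segment 0 (real n *\<^sub>R q) + closed_segment 0 q = closed_segment 0 (real (Suc n) *\<^sub>R q)"
    using closed_segment_0_add[of "real n" 1 q] by (simp add: add.commute)
  then show ?case using Suc by (simp add: lattice_cells_heighten add.assoc)
qed simp

text \<open>Each cell is a translate of the image of the half-open unit square \<open>C\<close>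
  under a linear map of determinant \<open>cross2 p q\<close>, and uniqueness of coordinates makes
  the cells disjoint.\<close>

lemma measure_lattice_cells:
  assumes "cross2 p q \<noteq> 0" "finite S"
  shows "lattice_cells p q S \<in> lmeasurable"
    and "measure lebesgue (lattice_cells p q S) = card S * \<bar>cross2 p q\<bar>"
proof -
  define f where "f = (\<lambda>x::real^2. x$1 *\<^sub>R p + x$2 *\<^sub>R q)"
  define C where "C = {x::real^2. \<lfloor>x$1\<rfloor> = 0 \<and> \<lfloor>x$2\<rfloor> = 0}"
  have lin: "linear f" by (auto simp: f_def linear_iff algebra_simps)
  have "matrix f = (\<chi> i j. if j = 1 then p$i else q$i)"
    by (auto simp: matrix_def f_def vec_eq_iff axis_def forall_2)
  then have detf: "det (matrix f) = cross2 p q" by (simp add: det_2 cross2_def)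
  have fl: "\<lfloor>t::real\<rfloor> = 0 \<longleftrightarrow> 0 \<le> t \<and> t < 1" for t by linarith
  have C_box: "sym_diff (cbox 0 1) C \<subseteq> cbox 0 1 - box 0 1"
    by (auto simp: C_def mem_box_cart forall_2 fl)
  then have neg: "negligible (sym_diff (cbox 0 1) C)"
    using negligible_frontier_interval negligible_subset by blast
  have ne: "cbox 0 (1::real^2) \<noteq> {}" by (simp add: interval_ne_empty_cart)
  have Cm: "C \<in> lmeasurable" "measure lebesgue C = 1"
    using lmeasurable_negligible_symdiff[OF lmeasurable_cbox neg]
      measure_negligible_symdiff[OF lmeasurable_cbox neg] ne by (auto simp: content_cbox_if_cart)
  have fC: "f ` C \<in> lmeasurable" "measure lebesgue (f ` C) = \<bar>cross2 p q\<bar>"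
    using measure_linear_image[OF lin Cm(1)] measurable_linear_image[OF lin Cm(1)] Cm(2) detf by auto
  define F where "F = (\<lambda>(i, j). (+) (of_int i *\<^sub>R p + of_int j *\<^sub>R q) ` f ` C)"
  have F: "F s \<in> lmeasurable" "measure lebesgue (F s) = \<bar>cross2 p q\<bar>" for s
    using fC by (auto simp: F_def split_def measurable_translation measure_translation)
  have mem_F: "z \<in> F (i, j) \<longleftrightarrow> (\<exists>a b. z = a *\<^sub>R p + b *\<^sub>R q \<and> \<lfloor>a\<rfloor> = i \<and> \<lfloor>b\<rfloor> = j)" for z i j
  proof
    assume "z \<in> F (i, j)"
    then obtain x where "x \<in> C" "z = (of_int i *\<^sub>R p + of_int j *\<^sub>R q) + f x"
      by (auto simp: F_def)
    then have "z = (of_int i + x$1) *\<^sub>R p + (of_int j + x$2) *\<^sub>R q"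
        "\<lfloor>of_int i + x$1\<rfloor> = i" "\<lfloor>of_int j + x$2\<rfloor> = j"
      by (auto simp: f_def C_def algebra_simps)
    then show "\<exists>a b. z = a *\<^sub>R p + b *\<^sub>R q \<and> \<lfloor>a\<rfloor> = i \<and> \<lfloor>b\<rfloor> = j" by blast
  next
    assume "\<exists>a b. z = a *\<^sub>R p + b *\<^sub>R q \<and> \<lfloor>a\<rfloor> = i \<and> \<lfloor>b\<rfloor> = j"
    then obtain a b where z: "z = a *\<^sub>R p + b *\<^sub>R q" "\<lfloor>a\<rfloor> = i" "\<lfloor>b\<rfloor> = j" by blast
    define x :: "real^2" where "x = vector [a - of_int i, b - of_int j]"
    have "x \<in> C" using z by (auto simp: C_def x_def)
    moreover have "z = (of_int i *\<^sub>R p + of_int j *\<^sub>R q) + f x"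
      by (simp add: f_def x_def z(1) algebra_simps)
    ultimately show "z \<in> F (i, j)" by (auto simp: F_def)
  qed
  have eq: "lattice_cells p q S = \<Union>(F ` S)"
  proof (intro set_eqI iffI)
    fix z assume "z \<in> lattice_cells p q S"
    then show "z \<in> \<Union>(F ` S)" unfolding lattice_cells_def using mem_F by blast
  next
    fix z assume "z \<in> \<Union>(F ` S)"
    then obtain i j where "(i, j) \<in> S" "z \<in> F (i, j)" by force
    then show "z \<in> lattice_cells p q S" unfolding mem_F lattice_cells_def by blast
  qed
  have disj: "pairwise (\<lambda>s t. disjnt (F s) (F t)) S"
  proof (rule pairwiseI)
    fix s t :: "int \<times> int" assume st: "s \<noteq> t"
    obtain i j k l where s: "s = (i, j)" and t: "t = (k, l)" by fastforce
    have "False" if z: "z \<in> F s" "z \<in> F t" for z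
    proof -
      obtain a b where ab: "z = a *\<^sub>R p + b *\<^sub>R q" "\<lfloor>a\<rfloor> = i" "\<lfloor>b\<rfloor> = j" using z(1) s mem_F by blast
      obtain c d where cd: "z = c *\<^sub>R p + d *\<^sub>R q" "\<lfloor>c\<rfloor> = k" "\<lfloor>d\<rfloor> = l" using z(2) t mem_F by blast
      have "a = c" "b = d"
        using cross2_coords_unique[OF assms(1) ab(1)] cross2_coords_unique[OF assms(1) cd(1)] by simp_all
      then show False using st s t ab cd by simp
    qed
    then show "disjnt (F s) (F t)" by (auto simp: disjnt_def)
  qed
  show "lattice_cells p q S \<in> lmeasurable"
    unfolding eq using assms(2) F by (intro fmeasurable.finite_UN) auto
  show "measure lebesgue (lattice_cells p q S) = card S * \<bar>cross2 p q\<bar>"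
    unfolding eq using measure_UNION'[OF assms(2) F(1) disj] F(2) by simp
qed

section \<open>Mixed differences of area for segments\<close>

text \<open>The union of the cells that meet \<open>M\<close> contains \<open>M\<close> and stays
  within distance \<open>d\<close> of it. The areas on the left are bounded by those of cell unions
  from outside, the areas of cell unions on the right by thickened sums; in between stands the grid
  inequality multiplied by the cell area.\<close>

lemma mixed_difference_lattice:
  fixes M :: "(real^2) set"
  assumes M: "compact M" "connected M" and pq: "cross2 p q \<noteq> 0"
  defines "d \<equiv> norm p + norm q"
  shows "measure lebesgue (M + closed_segment 0 (real n *\<^sub>R p) + closed_segment 0 (real n *\<^sub>R q)) + measure lebesgue M
    \<le> measure lebesgue (M + closed_segment 0 (real n *\<^sub>R p) + cball 0 d)
      + measure lebesgue (M + closed_segment 0 (real n *\<^sub>R q) + cball 0 d) + (real n)\<^sup>2 * \<bar>cross2 p q\<bar>"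
proof -
  define X where "X z = cross2 z q / cross2 p q" for z
  define Y where "Y z = cross2 p z / cross2 p q" for z
  define S where "S = (\<lambda>z. (\<lfloor>X z\<rfloor>, \<lfloor>Y z\<rfloor>)) ` M"
  have coords: "z = X z *\<^sub>R p + Y z *\<^sub>R q" for z
    using cross2_coords[OF pq] by (simp add: X_def Y_def)
  have contX: "continuous_on A X" and contY: "continuous_on A Y" for A
    unfolding X_def Y_def cross2_def using pq by (intro continuous_intros; simp add: cross2_def)+
  have finS: "finite S"
  proof -
    have "bounded (X ` M)" "bounded (Y ` M)"
      by (intro compact_imp_bounded compact_continuous_image contX contY M)+
    then obtain B C where BC: "\<And>z. z \<in> M \<Longrightarrow> \<bar>X z\<bar> \<le> B" "\<And>z. z \<in> M \<Longrightarrow> \<bar>Y z\<bar> \<le> C"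
      unfolding bounded_iff by auto
    have "S \<subseteq> {\<lfloor>-B\<rfloor>..\<lfloor>B\<rfloor>} \<times> {\<lfloor>-C\<rfloor>..\<lfloor>C\<rfloor>}"
    proof
      fix s assume "s \<in> S"
      then obtain z where z: "z \<in> M" "s = (\<lfloor>X z\<rfloor>, \<lfloor>Y z\<rfloor>)" by (auto simp: S_def)
      have "-B \<le> X z" "X z \<le> B" "-C \<le> Y z" "Y z \<le> C"
        using BC[OF z(1)] by auto
      then show "s \<in> {\<lfloor>-B\<rfloor>..\<lfloor>B\<rfloor>} \<times> {\<lfloor>-C\<rfloor>..\<lfloor>C\<rfloor>}"
        using z(2) by (simp only: mem_Times_iff fst_conv snd_conv atLeastAtMost_iff floor_mono)
    qed
    then show ?thesis by (rule finite_subset) simp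
  qed
  have conS: "grid_connected S"
    unfolding grid_connected_def
  proof (intro allI impI, elim conjE, rule ccontr)
    fix A B assume AB: "S = A \<union> B" "A \<noteq> {}" "B \<noteq> {}" and no: "\<not> (\<exists>a\<in>A. \<exists>b\<in>B. grid_adjacent a b)"
    \<comment> \<open>\<open>R s\<close> is the closed cell. Closed cells with a common point have
      adjacent indices, so a splitting without adjacency would cover \<open>M\<close> by two
      disjoint closed sets, both meeting \<open>M\<close>.\<close>
    define R where "R s = {z. of_int (fst s) \<le> X z \<and> X z \<le> of_int (fst s) + 1
        \<and> of_int (snd s) \<le> Y z \<and> Y z \<le> of_int (snd s) + 1}" for s :: "int \<times> int"
    have "closed (R s)" for s
      unfolding R_def by (intro closed_Collect_conj closed_Collect_le contX contY continuous_intros)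
    moreover have "finite A" "finite B" using finS AB(1) by auto
    ultimately have cl: "closed (\<Union>(R ` A))" "closed (\<Union>(R ` B))" by auto
    have inR: "z \<in> R (\<lfloor>X z\<rfloor>, \<lfloor>Y z\<rfloor>)" for z unfolding R_def by (auto; linarith)
    have "M \<subseteq> \<Union>(R ` A) \<union> \<Union>(R ` B)"
    proof
      fix z assume "z \<in> M"
      then have "(\<lfloor>X z\<rfloor>, \<lfloor>Y z\<rfloor>) \<in> A \<union> B" using AB(1) by (auto simp: S_def)
      then show "z \<in> \<Union>(R ` A) \<union> \<Union>(R ` B)" using inR[of z] by blast
    qed
    moreover have "\<Union>(R ` A) \<inter> \<Union>(R ` B) \<inter> M = {}"
    proof -
      have False if "a \<in> A" "b \<in> B" "z \<in> R a" "z \<in> R b" for a b z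
      proof -
        have "grid_adjacent a b" using that(3,4) unfolding R_def grid_adjacent_def by simp linarith
        then show False using no that by blast
      qed
      then show ?thesis by blast
    qed
    moreover have meet: "\<Union>(R ` T) \<inter> M \<noteq> {}" if T: "T \<subseteq> S" "T \<noteq> {}" for T
    proof -
      obtain s where s: "s \<in> T" using T by blast
      then obtain z where "z \<in> M" "s = (\<lfloor>X z\<rfloor>, \<lfloor>Y z\<rfloor>)" using T by (auto simp: S_def)
      then show ?thesis using inR[of z] s by blast
    qed
    moreover have "\<Union>(R ` A) \<inter> M \<noteq> {}" "\<Union>(R ` B) \<inter> M \<noteq> {}"
      using meet[of A] meet[of B] AB by blast+
    ultimately show False using connected_closedD[OF M(2) _ _ cl] by metis
  qed
  let ?U = "lattice_cells p q" and ?P = "closed_segment 0 (real n *\<^sub>R p)" and ?Q = "closed_segment 0 (real n *\<^sub>R q)"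
  have MU: "M \<subseteq> ?U S"
    unfolding lattice_cells_def S_def using coords by blast
  have UM: "?U S \<subseteq> M + cball 0 d"
  proof
    fix w assume "w \<in> ?U S"
    then obtain a b z where w: "w = a *\<^sub>R p + b *\<^sub>R q" and z: "z \<in> M" "\<lfloor>a\<rfloor> = \<lfloor>X z\<rfloor>" "\<lfloor>b\<rfloor> = \<lfloor>Y z\<rfloor>"
      unfolding lattice_cells_def S_def by auto
    \<comment> \<open>Two points of the same cell differ by at most 1 in each lattice coordinate,
      which gives the distance \<open>d\<close>.\<close>
    have ab: "\<bar>a - X z\<bar> \<le> 1" "\<bar>b - Y z\<bar> \<le> 1" using z by linarith+
    have "w - z = (a - X z) *\<^sub>R p + (b - Y z) *\<^sub>R q"
      using coords[of z] w by (simp add: algebra_simps)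
    then have "norm (w - z) \<le> \<bar>a - X z\<bar> * norm p + \<bar>b - Y z\<bar> * norm q"
      by (metis norm_scaleR norm_triangle_ineq real_norm_def)
    also have "\<dots> \<le> d" unfolding d_def using ab by (intro add_mono mult_left_le_one_le) auto
    finally have "z + (w - z) \<in> M + cball 0 d" using z by (intro set_plus_intro) auto
    then show "w \<in> M + cball 0 d" by simp
  qed
  have cM: "compact (M + ?P)" "compact (M + ?Q)" "compact (M + ?P + ?Q)"
      "compact (M + ?P + cball 0 d)" "compact (M + ?Q + cball 0 d)"
    by (intro compact_set_plus M compact_segment compact_cball)+
  have fin: "finite ((widen ^^ n) T)" "finite ((heighten ^^ n) T)" if "finite T" for T
    using that by (induction n) auto
  note fm = measure_lattice_cells[OF pq]
  have "M + ?P + ?Q \<subseteq> ?U S + ?P + ?Q" using MU by (intro set_plus_mono2) auto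
  also have "\<dots> = ?U ((widen ^^ n) ((heighten ^^ n) S))"
    by (simp add: lattice_cells_widen_funpow lattice_cells_heighten_funpow ac_simps)
  finally have "measure lebesgue (M + ?P + ?Q) \<le> measure lebesgue (?U ((widen ^^ n) ((heighten ^^ n) S)))"
    using fin finS fm cM by (intro measure_mono_fmeasurable) (auto simp: lmeasurable_compact fmeasurableD)
  moreover have "measure lebesgue M \<le> measure lebesgue (?U S)"
    using MU finS fm M by (intro measure_mono_fmeasurable) (auto simp: lmeasurable_compact fmeasurableD)
  moreover have "measure lebesgue (?U ((widen ^^ n) S)) \<le> measure lebesgue (M + ?P + cball 0 d)"
  proof (rule measure_mono_compact)
    have "?U S + ?P \<subseteq> M + cball 0 d + ?P" using UM by (intro set_plus_mono2) auto
    then show "?U ((widen ^^ n) S) \<subseteq> M + ?P + cball 0 d"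
      by (simp add: lattice_cells_widen_funpow ac_simps)
  qed (use fm fin finS cM in \<open>auto simp: fmeasurableD\<close>)
  moreover have "measure lebesgue (?U ((heighten ^^ n) S)) \<le> measure lebesgue (M + ?Q + cball 0 d)"
  proof (rule measure_mono_compact)
    have "?U S + ?Q \<subseteq> M + cball 0 d + ?Q" using UM by (intro set_plus_mono2) auto
    then show "?U ((heighten ^^ n) S) \<subseteq> M + ?Q + cball 0 d"
      by (simp add: lattice_cells_heighten_funpow ac_simps)
  qed (use fm fin finS cM in \<open>auto simp: fmeasurableD\<close>)
  moreover have "measure lebesgue (?U ((widen ^^ n) ((heighten ^^ n) S))) + measure lebesgue (?U S)
      \<le> measure lebesgue (?U ((widen ^^ n) S)) + measure lebesgue (?U ((heighten ^^ n) S)) + (real n)\<^sup>2 * \<bar>cross2 p q\<bar>"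
  proof -
    have "real (card ((widen ^^ n) ((heighten ^^ n) S))) + real (card S)
        \<le> real (card ((widen ^^ n) S)) + real (card ((heighten ^^ n) S)) + (real n)\<^sup>2"
      using grid_euler_iterated[OF finS conS, of n n] by (simp add: power2_eq_square flip: of_nat_add of_nat_mult)
    then have "(real (card ((widen ^^ n) ((heighten ^^ n) S))) + real (card S)) * \<bar>cross2 p q\<bar>
        \<le> (real (card ((widen ^^ n) S)) + real (card ((heighten ^^ n) S)) + (real n)\<^sup>2) * \<bar>cross2 p q\<bar>"
      by (intro mult_right_mono) auto
    then show ?thesis using fm fin finS by (simp add: algebra_simps)
  qed
  ultimately show ?thesis by linarith
qed

text \<open>Use the lattice spanned by \<open>u / N\<close> and \<open>v / N\<close> with
  \<open>N\<close> repetitions: the factor \<open>N^2\<close> cancels against the cell area, and the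
  thickening radius \<open>d n\<close> tends to 0 from the right.\<close>

lemma mixed_difference_independent:
  fixes M :: "(real^2) set"
  assumes M: "compact M" "connected M" and uv: "cross2 u v \<noteq> 0"
  shows "measure lebesgue (M + closed_segment 0 u + closed_segment 0 v) + measure lebesgue M
    \<le> measure lebesgue (M + closed_segment 0 u) + measure lebesgue (M + closed_segment 0 v) + \<bar>cross2 u v\<bar>"
proof -
  let ?P = "closed_segment 0 u" and ?Q = "closed_segment 0 v"
  define d where "d n = (norm u + norm v) / real (Suc n)" for n
  have nz: "u \<noteq> 0" using uv by (auto simp: cross2_def)
  have "d \<longlonglongrightarrow> 0"
    unfolding d_def using LIMSEQ_Suc[OF lim_const_over_n[of "norm u + norm v"]] by simp
  moreover have "d n > 0" for n
    using nz by (auto simp: d_def intro!: divide_pos_pos add_pos_nonneg)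
  ultimately have d: "filterlim d (at_right 0) sequentially"
    by (intro tendsto_imp_filterlim_at_right) auto
  have bound: "measure lebesgue (M + ?P + ?Q) + measure lebesgue M
      \<le> measure lebesgue (M + ?P + cball 0 (d n)) + measure lebesgue (M + ?Q + cball 0 (d n)) + \<bar>cross2 u v\<bar>" for n
  proof -
    define N where "N = Suc n"
    have N: "real N > 0" by (simp add: N_def)
    have c: "cross2 (inverse (real N) *\<^sub>R u) (inverse (real N) *\<^sub>R v) = cross2 u v / (real N)\<^sup>2"
      using N by (simp add: cross2_def field_simps power2_eq_square)
    have dn: "norm (inverse (real N) *\<^sub>R u) + norm (inverse (real N) *\<^sub>R v) = d n"
      by (simp add: d_def N_def add_divide_distrib divide_inverse algebra_simps)
    show ?thesis
      using mixed_difference_lattice[OF M, of "inverse (real N) *\<^sub>R u" "inverse (real N) *\<^sub>R v" N] uv N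
      unfolding c dn by (simp add: abs_divide del: of_nat_Suc)
  qed
  have cM: "compact (M + ?P)" "compact (M + ?Q)"
    by (intro compact_set_plus M compact_segment)+
  have "(\<lambda>n. measure lebesgue (M + ?P + cball 0 (d n)) + measure lebesgue (M + ?Q + cball 0 (d n)) + \<bar>cross2 u v\<bar>)
      \<longlonglongrightarrow> measure lebesgue (M + ?P) + measure lebesgue (M + ?Q) + \<bar>cross2 u v\<bar>"
    by (intro tendsto_intros filterlim_compose[OF tendsto_measure_parallel d] cM)
  then show ?thesis by (rule LIMSEQ_le_const) (use bound in blast)
qed

text \<open>Removes the independence of \<open>u\<close> and \<open>v\<close>: for
  \<open>u = 0\<close> both sides agree, and a nonzero \<open>u\<close> parallel to \<open>v\<close>
  is a limit of independent cases.\<close>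

lemma mixed_difference_segments_0:
  fixes M :: "(real^2) set"
  assumes M: "compact M" "connected M"
  shows "measure lebesgue (M + closed_segment 0 u + closed_segment 0 v) + measure lebesgue M
    \<le> measure lebesgue (M + closed_segment 0 u) + measure lebesgue (M + closed_segment 0 v) + \<bar>cross2 u v\<bar>"
proof (cases "cross2 u v = 0 \<and> u \<noteq> 0")
  case False
  then show ?thesis using mixed_difference_independent[OF M] by (cases "u = 0") auto
next
  case True
  \<comment> \<open>Rotate \<open>v\<close> slightly and absorb the error by a small ball added to \<open>M\<close>.\<close>
  define w :: "real^2" where "w = vector [- (u$2), u$1]"
  have uw: "cross2 u w = (norm u)\<^sup>2"
    by (simp add: cross2_def w_def power2_norm_eq_inner inner_vec_def sum_2)
  have nw: "norm w = norm u"
    by (simp add: norm_eq_sqrt_inner inner_vec_def sum_2 w_def)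
  let ?P = "closed_segment 0 u" and ?Q = "\<lambda>v. closed_segment 0 v"
  \<comment> \<open>The radius \<open>2 * r\<close> consists of one \<open>r\<close> for thickening
    \<open>M\<close> and another for returning from the rotated vector to \<open>v\<close>.\<close>
  have bound: "measure lebesgue (M + ?P + ?Q v) + measure lebesgue M
      \<le> measure lebesgue (M + ?P + cball 0 (2 * r)) + measure lebesgue (M + ?Q v + cball 0 (2 * r)) + r * norm u" if r: "r > 0" for r
  proof -
    define v' where "v' = v + (r / norm u) *\<^sub>R w"
    have vv: "norm (v' - v) = r" using r True nw by (simp add: v'_def)
    have cr: "cross2 u v' = r * norm u"
    proof -
      have "cross2 u v' = cross2 u v + (r / norm u) * cross2 u w"
        by (simp add: cross2_def v'_def algebra_simps)
      then show ?thesis using True uw by (simp add: power2_eq_square)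
    qed
    have seg: "?Q a \<subseteq> ?Q b + cball 0 r" if ab: "norm (a - b) = r" for a b :: "real^2"
    proof
      fix z assume "z \<in> ?Q a"
      then obtain t where t: "0 \<le> t" "t \<le> 1" "z = t *\<^sub>R a" by (auto simp: closed_segment_def)
      have "t *\<^sub>R b + t *\<^sub>R (a - b) \<in> ?Q b + cball 0 r"
        using t r ab by (intro set_plus_intro) (auto simp: closed_segment_def mult_left_le_one_le)
      then show "z \<in> ?Q b + cball 0 r" using t by (simp add: algebra_simps)
    qed
    let ?M = "M + cball 0 r"
    have c: "compact ?M" "connected ?M"
      using M by (auto intro: compact_set_plus connected_set_plus)
    have cs: "compact (M + ?P + ?Q v)" "compact (?M + ?P + ?Q v')" "compact (?M + ?P)" "compact (?M + ?Q v')"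
        "compact (M + ?P + cball 0 (2 * r))" "compact (M + ?Q v + cball 0 (2 * r))"
      using M by (intro compact_set_plus compact_segment compact_cball; simp)+
    have sets: "A \<in> sets lebesgue" if "compact A" for A :: "(real^2) set"
      using that lmeasurable_compact by blast
    have balls: "cball 0 r + cball 0 r \<subseteq> cball (0::real^2) (2 * r)"
    proof
      fix z :: "real^2" assume "z \<in> cball 0 r + cball 0 r"
      then obtain x y where "z = x + y" "norm x \<le> r" "norm y \<le> r" by (auto elim!: set_plus_elim)
      then show "z \<in> cball 0 (2 * r)" using norm_triangle_ineq[of x y] by simp
    qed
    have "?Q v \<subseteq> ?Q v' + cball 0 r" using seg vv by (simp add: norm_minus_commute)
    then have "M + ?P + ?Q v \<subseteq> M + ?P + (?Q v' + cball 0 r)" by (intro set_plus_mono2) auto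
    then have 1: "measure lebesgue (M + ?P + ?Q v) \<le> measure lebesgue (?M + ?P + ?Q v')"
      by (intro measure_mono_compact sets cs) (simp add: ac_simps)
    have "M + {0} \<subseteq> ?M" using r by (intro set_plus_mono2) auto
    then have 2: "measure lebesgue M \<le> measure lebesgue ?M"
      using c M by (intro measure_mono_compact sets) auto
    have "cball 0 r \<subseteq> cball (0::real^2) (2 * r)" using r by auto
    then have "M + ?P + cball 0 r \<subseteq> M + ?P + cball 0 (2 * r)" by (intro set_plus_mono2) auto
    then have 3: "measure lebesgue (?M + ?P) \<le> measure lebesgue (M + ?P + cball 0 (2 * r))"
      by (intro measure_mono_compact sets cs) (simp add: ac_simps)
    have "M + cball 0 r + ?Q v' \<subseteq> M + cball 0 r + (?Q v + cball 0 r)"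
      using seg vv by (intro set_plus_mono2) auto
    also have "\<dots> = M + ?Q v + (cball 0 r + cball 0 r)" by (simp add: ac_simps)
    also have "\<dots> \<subseteq> M + ?Q v + cball 0 (2 * r)" using balls by (intro set_plus_mono2) auto
    finally have 4: "measure lebesgue (?M + ?Q v') \<le> measure lebesgue (M + ?Q v + cball 0 (2 * r))"
      by (intro measure_mono_compact sets cs)
    have "cross2 u v' \<noteq> 0" using cr r True by simp
    from mixed_difference_independent[OF c this] 1 2 3 4 show ?thesis using cr r by simp
  qed
  have cM: "compact (M + ?P)" "compact (M + ?Q v)"
    by (intro compact_set_plus M compact_segment)+
  have "((\<lambda>r::real. 2 * r) \<longlongrightarrow> 2 * 0) (at_right 0)" by (intro tendsto_intros)
  then have lim: "filterlim (\<lambda>r::real. 2 * r) (at_right 0) (at_right 0)"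
    using eventually_at_right_less[of "0::real"] by (intro tendsto_imp_filterlim_at_right) (auto elim: eventually_mono)
  have "((\<lambda>r. measure lebesgue (M + ?P + cball 0 (2 * r)) + measure lebesgue (M + ?Q v + cball 0 (2 * r)) + r * norm u)
      \<longlongrightarrow> measure lebesgue (M + ?P) + measure lebesgue (M + ?Q v) + 0 * norm u) (at_right 0)"
    by (intro tendsto_intros filterlim_compose[OF tendsto_measure_parallel lim] cM)
  then have "measure lebesgue (M + ?P + ?Q v) + measure lebesgue M
      \<le> measure lebesgue (M + ?P) + measure lebesgue (M + ?Q v) + 0 * norm u"
    by (rule tendsto_lowerbound)
      (use bound eventually_at_right_less[of "0::real"] in \<open>auto elim: eventually_mono\<close>)
  then show ?thesis using True by simp
qed

section \<open>Zonotopes and the disc\<close>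

text \<open>Symmetry about the origin lets sums of such segments be compared with discs about the
  origin.\<close>

abbreviation centred_segment :: "'a::real_vector \<Rightarrow> 'a set" where
  "centred_segment u \<equiv> closed_segment (- u) u"

lemma set_plus_translation: "A + (+) c ` B = (+) c ` (A + B)" for A :: "'a::ab_group_add set"
  by (force simp: set_plus_def ac_simps)

text \<open>A centred segment is a translate of \<open>closed_segment 0 (2 *\<^sub>R w)\<close>, and
  translation preserves area. Doubling both vectors produces the factor 4.\<close>

lemma mixed_difference_segments:
  fixes M :: "(real^2) set"
  assumes M: "compact M" "connected M"
  shows "measure lebesgue (M + centred_segment u + centred_segment v) + measure lebesgue M
    \<le> measure lebesgue (M + centred_segment u) + measure lebesgue (M + centred_segment v) + 4 * \<bar>cross2 u v\<bar>"
proof -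
  have seg: "centred_segment w = (+) (- w) ` closed_segment 0 (2 *\<^sub>R w)" for w :: "real^2"
    using closed_segment_translation[of "- w" 0 "2 *\<^sub>R w"] by (simp add: scaleR_2)
  have single: "measure lebesgue (N + centred_segment w) = measure lebesgue (N + closed_segment 0 (2 *\<^sub>R w))" for N and w :: "real^2"
    unfolding seg set_plus_translation measure_translation ..
  have "measure lebesgue (M + centred_segment u + centred_segment v)
      = measure lebesgue (M + centred_segment u + closed_segment 0 (2 *\<^sub>R v))" by (rule single)
  also have "\<dots> = measure lebesgue (M + closed_segment 0 (2 *\<^sub>R v) + centred_segment u)"
    by (simp add: ac_simps)
  also have "\<dots> = measure lebesgue (M + closed_segment 0 (2 *\<^sub>R v) + closed_segment 0 (2 *\<^sub>R u))"
    by (rule single)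
  also have "\<dots> = measure lebesgue (M + closed_segment 0 (2 *\<^sub>R u) + closed_segment 0 (2 *\<^sub>R v))"
    by (simp add: ac_simps)
  finally have eq: "measure lebesgue (M + centred_segment u + centred_segment v)
      = measure lebesgue (M + closed_segment 0 (2 *\<^sub>R u) + closed_segment 0 (2 *\<^sub>R v))" .
  have "cross2 (2 *\<^sub>R u) (2 *\<^sub>R v) = 4 * cross2 u v" by (simp add: cross2_def)
  then have "\<bar>cross2 (2 *\<^sub>R u) (2 *\<^sub>R v)\<bar> = 4 * \<bar>cross2 u v\<bar>" by (simp add: abs_mult)
  then show ?thesis
    using mixed_difference_segments_0[OF M, of "2 *\<^sub>R u" "2 *\<^sub>R v"]
      eq single[of M u] single[of M v] by linarith
qed

section \<open>From two segments to two zonotopes\<close>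

lemma compact_set_sum:
  fixes F :: "'i \<Rightarrow> 'a::real_normed_vector set"
  shows "(\<And>i. i \<in> A \<Longrightarrow> compact (F i)) \<Longrightarrow> compact (sum F A)"
  by (induction A rule: infinite_finite_induct) (auto intro: compact_set_plus)

text \<open>The induction hypothesis for \<open>M + ?S\<close> and the two-segment bound for
  \<open>M\<close> are added; the areas of \<open>M + ?S\<close> and
  \<open>M + centred_segment u + ?S\<close> cancel.\<close>

lemma mixed_difference_segment_zonotope:
  fixes M :: "(real^2) set" and v :: "'i \<Rightarrow> real^2"
  assumes "finite B" "compact M" "connected M"
  shows "measure lebesgue (M + centred_segment u + (\<Sum>j\<in>B. centred_segment (v j))) + measure lebesgue M
    \<le> measure lebesgue (M + centred_segment u) + measure lebesgue (M + (\<Sum>j\<in>B. centred_segment (v j)))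
      + 4 * (\<Sum>j\<in>B. \<bar>cross2 u (v j)\<bar>)"
  using assms
proof (induction B arbitrary: M rule: finite_induct)
  case (insert k B)
  let ?Z = "\<Sum>j\<in>B. centred_segment (v j)" and ?S = "centred_segment (v k)"
  have "compact (M + ?S)" "connected (M + ?S)"
    using insert.prems by (auto intro: compact_set_plus connected_set_plus)
  from insert.IH[OF this] mixed_difference_segments[OF insert.prems, of u "v k"]
  show ?case using insert.hyps by (simp add: ac_simps distrib_left)
qed simp

text \<open>The same telescoping, now over the segments of the first zonotope.\<close>

lemma mixed_difference_zonotopes:
  fixes M :: "(real^2) set" and u :: "'i \<Rightarrow> real^2" and v :: "'j \<Rightarrow> real^2"
  assumes "finite A" "finite B" "compact M" "connected M"
  shows "measure lebesgue (M + (\<Sum>i\<in>A. centred_segment (u i)) + (\<Sum>j\<in>B. centred_segment (v j))) + measure lebesgue M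
    \<le> measure lebesgue (M + (\<Sum>i\<in>A. centred_segment (u i))) + measure lebesgue (M + (\<Sum>j\<in>B. centred_segment (v j)))
      + 4 * (\<Sum>i\<in>A. \<Sum>j\<in>B. \<bar>cross2 (u i) (v j)\<bar>)"
  using assms(1,3,4)
proof (induction A arbitrary: M rule: finite_induct)
  case (insert k A)
  let ?S = "centred_segment (u k)"
  have "compact (M + ?S)" "connected (M + ?S)"
    using insert.prems by (auto intro: compact_set_plus connected_set_plus)
  from insert.IH[OF this] mixed_difference_segment_zonotope[OF assms(2) insert.prems, of "u k" v]
  show ?case using insert.hyps by (simp add: ac_simps distrib_left)
qed simp

text \<open>The sum has period \<open>2 * x\<close> in the angle, so the angle can be moved to a
  window where all cosines are nonnegative. There, multiplication by \<open>sin x\<close> makes the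
  sum telescope to \<open>sin (\<psi> + x)\<close>, which lies between \<open>cos x\<close> and
  1.\<close>

lemma sum_abs_cos_equidistributed:
  assumes "m \<ge> 1"
  defines "x \<equiv> pi / (2 * real m)"
  shows "cos x / sin x \<le> (\<Sum>j<m. \<bar>cos (\<phi> - real j * pi / m)\<bar>)"
    and "(\<Sum>j<m. \<bar>cos (\<phi> - real j * pi / m)\<bar>) \<le> 1 / sin x"
proof -
  define T where "T \<phi> = (\<Sum>j<m. \<bar>cos (\<phi> - real j * pi / m)\<bar>)" for \<phi> :: real
  have m: "real m > 0" using assms(1) by simp
  have x: "0 < x" "x \<le> pi / 2" and mx: "2 * real m * x = pi"
    using assms(1) by (auto simp: x_def field_simps)
  have sx: "sin x > 0" using x pi_gt_zero by (intro sin_gt_zero) linarith+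
  have angle: "real j * pi / m = 2 * x * real j" for j using m by (simp add: x_def)
  have T_alt: "T \<phi> = (\<Sum>j<m. \<bar>cos (\<phi> - 2 * x * real j)\<bar>)" for \<phi>
    unfolding T_def angle ..
  have step: "T (\<phi> + 2 * x) = T \<phi>" for \<phi>
  proof -
    \<comment> \<open>The shift renumbers the terms; the one that wraps around differs from the old
      last one by an angle pi, which the absolute value ignores.\<close>
    obtain k where k: "m = Suc k" using assms(1) by (cases m) auto
    have "T (\<phi> + 2 * x) = \<bar>cos (\<phi> + 2 * x)\<bar> + (\<Sum>j<k. \<bar>cos (\<phi> - 2 * x * real j)\<bar>)"
      unfolding T_alt k sum.lessThan_Suc_shift by (simp add: algebra_simps)
    moreover have "\<phi> + 2 * x = (\<phi> - 2 * x * real k) + pi"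
      using mx by (simp add: k algebra_simps)
    then have "\<bar>cos (\<phi> + 2 * x)\<bar> = \<bar>cos (\<phi> - 2 * x * real k)\<bar>" by (metis abs_minus_cancel cos_periodic_pi)
    ultimately show ?thesis unfolding T_alt k by simp
  qed
  have steps: "T (\<phi> + 2 * x * real k) = T \<phi>" for \<phi> k
  proof (induction k)
    case (Suc k)
    then show ?case using step[of "\<phi> + 2 * x * real k"] by (simp add: algebra_simps)
  qed simp
  have T_mod: "\<exists>\<psi>. T \<phi> = T \<psi> \<and> pi / 2 - 2 * x \<le> \<psi> \<and> \<psi> \<le> pi / 2" for \<phi>
  proof -
    define k where "k = \<lfloor>(pi / 2 - \<phi>) / (2 * x)\<rfloor>"
    define \<psi> where "\<psi> = \<phi> + 2 * x * of_int k"
    have "of_int k \<le> (pi / 2 - \<phi>) / (2 * x)" "(pi / 2 - \<phi>) / (2 * x) \<le> of_int k + 1"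
      unfolding k_def by linarith+
    then have "pi / 2 - 2 * x \<le> \<psi>" "\<psi> \<le> pi / 2"
      using x by (auto simp: \<psi>_def field_simps)
    moreover have "T \<phi> = T \<psi>"
    proof (cases "k \<ge> 0")
      case True
      then show ?thesis using steps[of \<phi> "nat k"] by (simp add: \<psi>_def)
    next
      case False
      then show ?thesis using steps[of \<psi> "nat (- k)"] by (simp add: \<psi>_def)
    qed
    ultimately show ?thesis by blast
  qed
  have T_eq: "T \<psi> * sin x = sin (\<psi> + x)" if \<psi>: "pi / 2 - 2 * x \<le> \<psi>" "\<psi> \<le> pi / 2" for \<psi>
  proof -
    have pos: "cos (\<psi> - 2 * x * real j) \<ge> 0" if "j < m" for j
    proof (rule cos_ge_zero)
      have "2 * x * (real j + 1) \<le> 2 * x * real m" using that x by (intro mult_left_mono) auto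
      then show "- (pi / 2) \<le> \<psi> - 2 * x * real j" using \<psi> mx by (simp add: algebra_simps)
      have "0 \<le> 2 * x * real j" using x by simp
      then show "\<psi> - 2 * x * real j \<le> pi / 2" using \<psi> by linarith
    qed
    have "2 * (cos (\<psi> - 2 * x * real j) * sin x)
        = sin (\<psi> + x - 2 * x * real j) - sin (\<psi> + x - 2 * x * real (Suc j))" for j
    proof -
      have "\<psi> + x - 2 * x * real j = (\<psi> - 2 * x * real j) + x"
        "\<psi> + x - 2 * x * real (Suc j) = (\<psi> - 2 * x * real j) - x" by (auto simp: algebra_simps)
      then show ?thesis by (simp only: sin_add sin_diff)
    qed
    then have "2 * (T \<psi> * sin x) = (\<Sum>j<m. sin (\<psi> + x - 2 * x * real j) - sin (\<psi> + x - 2 * x * real (Suc j)))"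
      unfolding T_alt using pos by (simp add: sum_distrib_left sum_distrib_right abs_of_nonneg)
    also have "\<dots> = sin (\<psi> + x) - sin (\<psi> + x - pi)"
      using sum_lessThan_telescope'[of "\<lambda>j. sin (\<psi> + x - 2 * x * real j)" m] mx by (simp add: algebra_simps)
    finally show ?thesis by (simp add: sin_diff)
  qed
  obtain \<psi> where \<psi>: "T \<phi> = T \<psi>" "pi / 2 - 2 * x \<le> \<psi>" "\<psi> \<le> pi / 2" using T_mod by blast
  have "cos x \<le> cos (pi / 2 - (\<psi> + x))"
  proof -
    have "\<bar>pi / 2 - (\<psi> + x)\<bar> \<le> x" using \<psi> by linarith
    then have "cos x \<le> cos \<bar>pi / 2 - (\<psi> + x)\<bar>" using x by (intro cos_monotone_0_pi_le) auto
    then show ?thesis by simp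
  qed
  then have "cos x \<le> T \<phi> * sin x" using T_eq[OF \<psi>(2,3)] \<psi>(1) by (simp add: cos_diff)
  then show "cos x / sin x \<le> (\<Sum>j<m. \<bar>cos (\<phi> - real j * pi / m)\<bar>)"
    using sx by (simp add: T_def field_simps)
  have "T \<phi> * sin x \<le> 1" using T_eq[OF \<psi>(2,3)] \<psi>(1) by simp
  then show "(\<Sum>j<m. \<bar>cos (\<phi> - real j * pi / m)\<bar>) \<le> 1 / sin x"
    using sx by (simp add: T_def field_simps)
qed

section \<open>Polar coordinates and circumscribed regular polygons\<close>

definition unit_vector :: "real \<Rightarrow> real^2" where
  "unit_vector \<theta> = vector [cos \<theta>, sin \<theta>]"

lemma polar_real2: "\<exists>\<phi>. a = norm a *\<^sub>R unit_vector \<phi>"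
proof (cases "a = 0")
  case False
  have n: "(norm a)\<^sup>2 = (a$1)\<^sup>2 + (a$2)\<^sup>2"
    unfolding power2_norm_eq_inner by (simp add: inner_vec_def sum_2 power2_eq_square)
  have "(a$1 / norm a)\<^sup>2 + (a$2 / norm a)\<^sup>2 = 1"
    using False by (simp add: power_divide n[symmetric] flip: add_divide_distrib)
  then obtain t where "a$1 / norm a = cos t" "a$2 / norm a = sin t"
    using sincos_total_2pi by metis
  then have "a$1 = norm a * cos t" "a$2 = norm a * sin t"
    using False by (auto simp: divide_eq_eq mult.commute)
  then have "a = norm a *\<^sub>R unit_vector t"
    unfolding vec_eq_iff forall_2 unit_vector_def by simp
  then show ?thesis by blast
qed simp

lemma inner_unit_vector: "unit_vector \<phi> \<bullet> unit_vector \<theta> = cos (\<phi> - \<theta>)"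
  by (simp add: unit_vector_def inner_vec_def sum_2 cos_diff)

text \<open>Written as a cosine instead of the sine of the angle difference, so that the bound on
  sums of absolute cosines applies.\<close>

lemma cross2_unit_vector: "cross2 (unit_vector \<phi>) (unit_vector \<theta>) = cos (\<phi> + pi / 2 - \<theta>)"
  by (simp add: unit_vector_def cross2_def cos_diff cos_add sin_add)

text \<open>The regular \<open>2m\<close>-gon circumscribed about the disc of radius \<open>s\<close>.\<close>

definition disc_polygon :: "nat \<Rightarrow> real \<Rightarrow> (real^2) set" where
  "disc_polygon m s = (\<Sum>j<m. centred_segment ((s * tan (pi / (2 * real m))) *\<^sub>R unit_vector (real j * pi / m)))"

text \<open>Both inclusions compare support functions. The disc is inside by separation from a
  hypothetical outside point; the polygon is inside the larger disc by testing each of its points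
  \<open>z\<close> in the direction \<open>z\<close> itself.\<close>

lemma
  assumes m: "m \<ge> 2" and s: "s > 0"
  defines "x \<equiv> pi / (2 * real m)"
  shows cball_subset_disc_polygon: "cball 0 s \<subseteq> disc_polygon m s"
    and disc_polygon_subset_cball: "disc_polygon m s \<subseteq> cball 0 (s / cos x)"
proof -
  define u where "u j = (s * tan x) *\<^sub>R unit_vector (real j * pi / m)" for j :: nat
  have Z: "disc_polygon m s = (\<Sum>j<m. centred_segment (u j))"
    by (simp add: disc_polygon_def u_def x_def)
  have x: "0 < x" "x < pi / 2" using m by (auto simp: x_def field_simps)
  have sx: "sin x > 0" "cos x > 0" "tan x > 0"
    using x by (auto intro: sin_gt_zero cos_gt_zero tan_gt_zero)
  \<comment> \<open>The middle sum is the support function of the polygon. The factor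
    \<open>s * tan x\<close> is chosen so that the lower trigonometric bound becomes exactly
    \<open>norm a * s\<close>.\<close>
  have support: "norm a * s \<le> (\<Sum>j<m. \<bar>a \<bullet> u j\<bar>)" "(\<Sum>j<m. \<bar>a \<bullet> u j\<bar>) \<le> norm a * (s / cos x)" for a
  proof -
    obtain \<phi> where \<phi>: "a = norm a *\<^sub>R unit_vector \<phi>" using polar_real2 by blast
    have "\<bar>a \<bullet> u j\<bar> = (norm a * s * tan x) * \<bar>cos (\<phi> - real j * pi / m)\<bar>" for j
      using s sx by (subst \<phi>) (simp add: u_def inner_unit_vector abs_mult)
    then have sum: "(\<Sum>j<m. \<bar>a \<bullet> u j\<bar>) = (norm a * s * tan x) * (\<Sum>j<m. \<bar>cos (\<phi> - real j * pi / m)\<bar>)"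
      by (simp add: sum_distrib_left)
    have "norm a * s = (norm a * s * tan x) * (cos x / sin x)"
      using sx by (simp add: tan_def)
    also have "\<dots> \<le> (\<Sum>j<m. \<bar>a \<bullet> u j\<bar>)"
      unfolding sum using sum_abs_cos_equidistributed(1)[of m \<phi>] m s sx
      by (intro mult_left_mono) (auto simp: x_def)
    finally show "norm a * s \<le> (\<Sum>j<m. \<bar>a \<bullet> u j\<bar>)" .
    have "(\<Sum>j<m. \<bar>a \<bullet> u j\<bar>) \<le> (norm a * s * tan x) * (1 / sin x)"
      unfolding sum using sum_abs_cos_equidistributed(2)[of m \<phi>] m s sx
      by (intro mult_left_mono) (auto simp: x_def)
    also have "\<dots> = norm a * (s / cos x)" using sx by (simp add: tan_def)
    finally show "(\<Sum>j<m. \<bar>a \<bullet> u j\<bar>) \<le> norm a * (s / cos x)" .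
  qed
  have seg: "t *\<^sub>R w \<in> centred_segment w" if "\<bar>t\<bar> \<le> 1" for t and w :: "real^2"
  proof -
    have "t *\<^sub>R w = (1 - (1 + t) / 2) *\<^sub>R (- w) + ((1 + t) / 2) *\<^sub>R w"
      by (simp add: vec_eq_iff field_simps)
    then show ?thesis using that unfolding closed_segment_def
      by (intro CollectI exI[of _ "(1 + t) / 2"]) (auto simp: abs_le_iff)
  qed
  have seg': "\<exists>t. \<bar>t\<bar> \<le> 1 \<and> z = t *\<^sub>R w" if z: "z \<in> centred_segment w" for z w :: "real^2"
  proof -
    obtain r where "0 \<le> r" "r \<le> 1" "z = (1 - r) *\<^sub>R (- w) + r *\<^sub>R w"
      using z by (auto simp: closed_segment_def)
    then show ?thesis by (intro exI[of _ "2 * r - 1"]) (auto simp: vec_eq_iff field_simps)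
  qed
  show "cball 0 s \<subseteq> disc_polygon m s"
  proof (rule subsetI, rule ccontr)
    fix z :: "real^2" assume z: "z \<in> cball 0 s" "z \<notin> disc_polygon m s"
    have "convex (disc_polygon m s)" unfolding Z by (intro convex_set_sum convex_closed_segment)
    moreover have "closed (disc_polygon m s)"
      unfolding Z by (intro compact_imp_closed compact_set_sum compact_segment)
    ultimately obtain a b where ab: "a \<bullet> z < b" "\<And>y. y \<in> disc_polygon m s \<Longrightarrow> b < a \<bullet> y"
      using separating_hyperplane_closed_point[OF _ _ z(2)] by blast
    \<comment> \<open>The point of the polygon where the inner product with \<open>a\<close> is
      smallest.\<close>
    define y where "y = (\<Sum>j<m. (- sgn (a \<bullet> u j)) *\<^sub>R u j)"
    have "y \<in> disc_polygon m s"
      unfolding Z set_sum_alt[OF finite_lessThan] y_def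
      by (intro CollectI exI[of _ "\<lambda>j. (- sgn (a \<bullet> u j)) *\<^sub>R u j"] conjI ballI seg) (auto simp: abs_sgn_eq)
    then have "b < a \<bullet> y" by (rule ab(2))
    also have "a \<bullet> y = - (\<Sum>j<m. \<bar>a \<bullet> u j\<bar>)"
      by (simp add: y_def inner_sum_right sum_negf abs_sgn mult.commute)
    also have "\<dots> \<le> - (norm a * s)" using support(1) by simp
    also have "\<dots> \<le> - (norm a * norm z)" using z by (simp add: mult_left_mono)
    also have "\<dots> \<le> a \<bullet> z" using Cauchy_Schwarz_ineq2[of a z] by linarith
    finally show False using ab(1) by simp
  qed
  show "disc_polygon m s \<subseteq> cball 0 (s / cos x)"
  proof
    fix z assume "z \<in> disc_polygon m s"
    then obtain f where f: "z = sum f {..<m}" "\<And>j. j < m \<Longrightarrow> f j \<in> centred_segment (u j)"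
      unfolding Z set_sum_alt[OF finite_lessThan] by auto
    have "z \<bullet> f j \<le> \<bar>z \<bullet> u j\<bar>" if "j < m" for j
    proof -
      obtain t where "\<bar>t\<bar> \<le> 1" "f j = t *\<^sub>R u j" using seg'[OF f(2)[OF \<open>j < m\<close>]] by blast
      then have "\<bar>z \<bullet> f j\<bar> \<le> \<bar>z \<bullet> u j\<bar>" by (simp add: abs_mult mult_left_le_one_le)
      then show ?thesis by linarith
    qed
    then have "(\<Sum>j<m. z \<bullet> f j) \<le> (\<Sum>j<m. \<bar>z \<bullet> u j\<bar>)" by (intro sum_mono) auto
    moreover have "(\<Sum>j<m. z \<bullet> f j) = norm z * norm z"
      by (simp add: f(1) flip: inner_sum_right power2_norm_eq_inner power2_eq_square)
    ultimately have "norm z * norm z \<le> norm z * (s / cos x)" using support(2)[of z] by linarith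
    then have "norm z \<le> s / cos x"
      using s sx by (cases "z = 0") (simp_all del: times_divide_eq_right)
    then show "z \<in> cball 0 (s / cos x)" by simp
  qed
qed

text \<open>Both zonotopes are the same polygon. With \<open>m = pi / (2 * x)\<close> the double sum
  is at most \<open>pi * s^2 / (2 * cos(x)^2)\<close> times \<open>sin x / x\<close>, and the last
  factor is at most 1.\<close>

lemma second_difference_disc_polygon:
  fixes M :: "(real^2) set"
  assumes m: "m \<ge> 2" and s: "s > 0" and M: "compact M" "connected M"
  defines "x \<equiv> pi / (2 * real m)"
  shows "measure lebesgue (M + disc_polygon m s + disc_polygon m s) + measure lebesgue M
    \<le> 2 * measure lebesgue (M + disc_polygon m s) + 2 * pi * s\<^sup>2 / (cos x)\<^sup>2"
proof -
  define u where "u j = (s * tan x) *\<^sub>R unit_vector (real j * pi / m)" for j :: nat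
  have Z: "disc_polygon m s = (\<Sum>j<m. centred_segment (u j))"
    by (simp add: disc_polygon_def u_def x_def)
  have x: "0 < x" "x < pi / 2" using m by (auto simp: x_def field_simps)
  have sx: "sin x > 0" "cos x > 0" "tan x > 0"
    using x by (auto intro: sin_gt_zero cos_gt_zero tan_gt_zero)
  have mx: "real m = pi / (2 * x)" using m by (simp add: x_def)
  have "(\<Sum>j<m. \<bar>cross2 (u i) (u j)\<bar>) \<le> (s * tan x)\<^sup>2 / sin x" for i
  proof -
    have "\<bar>cross2 (u i) (u j)\<bar> = (s * tan x)\<^sup>2 * \<bar>cos ((real i * pi / m + pi / 2) - real j * pi / m)\<bar>" for j
    proof -
      have "cross2 (u i) (u j) = (s * tan x)\<^sup>2 * cross2 (unit_vector (real i * pi / m)) (unit_vector (real j * pi / m))"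
        by (simp add: u_def cross2_def power2_eq_square algebra_simps)
      then show ?thesis by (simp add: cross2_unit_vector abs_mult)
    qed
    then have "(\<Sum>j<m. \<bar>cross2 (u i) (u j)\<bar>)
        = (s * tan x)\<^sup>2 * (\<Sum>j<m. \<bar>cos ((real i * pi / m + pi / 2) - real j * pi / m)\<bar>)"
      by (simp add: sum_distrib_left)
    also have "\<dots> \<le> (s * tan x)\<^sup>2 * (1 / sin x)"
      using sum_abs_cos_equidistributed(2)[of m "real i * pi / m + pi / 2"] m
      by (intro mult_left_mono) (auto simp: x_def)
    finally show ?thesis by simp
  qed
  then have "(\<Sum>i<m. \<Sum>j<m. \<bar>cross2 (u i) (u j)\<bar>) \<le> (\<Sum>i<m. (s * tan x)\<^sup>2 / sin x)"
    by (intro sum_mono)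
  also have "\<dots> = real m * ((s * tan x)\<^sup>2 / sin x)" by simp
  also have "\<dots> = pi * s\<^sup>2 / (2 * (cos x)\<^sup>2) * (sin x / x)"
    using sx x by (simp add: mx tan_def power2_eq_square field_simps)
  also have "\<dots> \<le> pi * s\<^sup>2 / (2 * (cos x)\<^sup>2) * 1"
    using sx x sin_x_le_x[of x] by (intro mult_left_mono) auto
  finally have "4 * (\<Sum>i<m. \<Sum>j<m. \<bar>cross2 (u i) (u j)\<bar>) \<le> 2 * pi * s\<^sup>2 / (cos x)\<^sup>2" by simp
  with mixed_difference_zonotopes[OF finite_lessThan finite_lessThan M, of u m u m]
  show ?thesis unfolding Z by linarith
qed

section \<open>Area of parallel sets\<close>

lemma cball_0_add:
  fixes a b :: real
  assumes "a \<ge> 0" "b \<ge> 0"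
  shows "cball 0 (a + b) = cball 0 a + (cball 0 b :: 'a::real_normed_vector set)"
proof (intro equalityI subsetI)
  fix z :: 'a assume z: "z \<in> cball 0 (a + b)"
  show "z \<in> cball 0 a + cball 0 b"
  proof (cases "a + b = 0")
    case True
    then show ?thesis using z assms by (simp add: add_nonneg_eq_0_iff)
  next
    case False
    then have ab: "a + b > 0" using assms by linarith
    have scale: "norm ((c / (a + b)) *\<^sub>R z) \<le> c" if "c \<ge> 0" for c
    proof -
      have "c / (a + b) * norm z \<le> c / (a + b) * (a + b)"
        using z ab that by (intro mult_left_mono) auto
      then show ?thesis using ab that by simp
    qed
    have "(a / (a + b)) *\<^sub>R z + (b / (a + b)) *\<^sub>R z \<in> cball 0 a + cball 0 b"
      using scale assms by (intro set_plus_intro) (auto simp del: norm_scaleR)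
    moreover have "(a / (a + b)) *\<^sub>R z + (b / (a + b)) *\<^sub>R z = z"
      using ab by (simp flip: scaleR_left_distrib add_divide_distrib)
    ultimately show ?thesis by simp
  qed
next
  fix z :: 'a assume "z \<in> cball 0 a + cball 0 b"
  then obtain x y where "z = x + y" "norm x \<le> a" "norm y \<le> b" by (auto elim!: set_plus_elim)
  then show "z \<in> cball 0 (a + b)" using norm_triangle_ineq[of x y] by simp
qed

text \<open>The increment at \<open>k\<close> exceeds the first one by at most \<open>k * w\<close>;
  summing over \<open>k < n\<close> gives the triangular number.\<close>

lemma second_difference_bound:
  fixes a :: "nat \<Rightarrow> real"
  assumes "\<And>k. a (Suc (Suc k)) + a k \<le> 2 * a (Suc k) + w"
  shows "a n - a 0 \<le> real n * (a 1 - a 0) + w * (real n * (real n - 1) / 2)"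
proof -
  have step: "a (Suc k) - a k \<le> (a 1 - a 0) + real k * w" for k
  proof (induction k)
    case (Suc k)
    then show ?case using assms[of k] by (simp add: algebra_simps)
  qed simp
  show ?thesis
  proof (induction n)
    case (Suc n)
    have "w * (real (Suc n) * (real (Suc n) - 1) / 2) = w * (real n * (real n - 1) / 2) + real n * w"
      by (simp add: field_simps)
    moreover have "real (Suc n) * (a 1 - a 0) = real n * (a 1 - a 0) + (a 1 - a 0)"
      by (simp add: algebra_simps)
    ultimately show ?case using Suc step[of n] by linarith
  qed simp
qed

text \<open>Discs are replaced by polygons: the \<open>n\<close>-fold sum of polygons contains the
  disc of radius \<open>n * s\<close>, and a single polygon lies in the disc of radius
  \<open>s / cos x\<close>. The second-difference bound is applied to the connected sets
  \<open>K + X k\<close>.\<close>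

lemma parallel_measure_polygon_bound:
  fixes K :: "(real^2) set"
  assumes K: "compact K" "connected K" and s: "s > 0" and m: "m \<ge> 2"
  defines "x \<equiv> pi / (2 * real m)"
  shows "measure lebesgue (K + cball 0 (real n * s)) - measure lebesgue K
    \<le> real n * (measure lebesgue (K + cball 0 (s / cos x)) - measure lebesgue K)
      + pi * s\<^sup>2 / (cos x)\<^sup>2 * (real n * (real n - 1))"
proof -
  let ?Z = "disc_polygon m s"
  define X where "X k = (\<Sum>i<k. ?Z)" for k :: nat
  define a where "a k = measure lebesgue (K + X k)" for k
  have Z: "compact ?Z" "connected ?Z"
    unfolding disc_polygon_def
    by (auto intro!: compact_set_sum convex_connected convex_set_sum)
  have X: "compact (X k) \<and> connected (X k)" for k
    by (induction k) (auto simp: X_def compact_set_plus connected_set_plus Z)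
  have KX: "compact (K + X k)" "connected (K + X k)" for k
    using K X by (auto intro: compact_set_plus connected_set_plus)
  have "a (Suc (Suc k)) + a k \<le> 2 * a (Suc k) + 2 * pi * s\<^sup>2 / (cos x)\<^sup>2" for k
    using second_difference_disc_polygon[OF m s KX[of k]] by (simp add: a_def X_def x_def ac_simps)
  from second_difference_bound[of a, OF this, of n]
  have main: "a n - a 0 \<le> real n * (a 1 - a 0) + pi * s\<^sup>2 / (cos x)\<^sup>2 * (real n * (real n - 1))"
    by simp
  have sets: "A \<in> sets lebesgue" if "compact A" for A :: "(real^2) set"
    using that lmeasurable_compact by blast
  have "cball 0 (real k * s) \<subseteq> X k" for k
  proof (induction k)
    case (Suc k)
    have "cball 0 (real (Suc k) * s) = cball 0 (real k * s) + (cball 0 s :: (real^2) set)"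
      using cball_0_add[of "real k * s" s] s by (simp add: algebra_simps)
    also have "\<dots> \<subseteq> X k + ?Z"
      using Suc cball_subset_disc_polygon[OF m s] by (intro set_plus_mono2)
    finally show ?case by (simp add: X_def)
  qed (simp add: X_def)
  then have "K + cball 0 (real n * s) \<subseteq> K + X n" by (intro set_plus_mono2) auto
  then have an: "measure lebesgue (K + cball 0 (real n * s)) \<le> a n"
    unfolding a_def using K X by (intro measure_mono_compact sets compact_set_plus compact_cball) auto
  have "K + X 1 \<subseteq> K + cball 0 (s / cos x)"
    using disc_polygon_subset_cball[OF m s] by (intro set_plus_mono2) (auto simp: X_def x_def)
  then have a1: "a 1 \<le> measure lebesgue (K + cball 0 (s / cos x))"
    unfolding a_def using K X by (intro measure_mono_compact sets compact_set_plus compact_cball) auto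
  have a0: "a 0 = measure lebesgue K" by (simp add: a_def X_def)
  have "real n * (a 1 - a 0) \<le> real n * (measure lebesgue (K + cball 0 (s / cos x)) - measure lebesgue K)"
    using a1 a0 by (intro mult_left_mono) auto
  then show ?thesis using main an a0 by linarith
qed

text \<open>Let the number of polygon sides grow: \<open>s / cos x\<close> decreases to
  \<open>s\<close>, and the area of thickenings is continuous from the right.\<close>

lemma parallel_measure_multiple_bound:
  fixes K :: "(real^2) set"
  assumes K: "compact K" "connected K" and s: "s > 0"
  shows "measure lebesgue (K + cball 0 (real n * s)) - measure lebesgue K
    \<le> real n * (measure lebesgue (K + cball 0 s) - measure lebesgue K) + pi * s\<^sup>2 * (real n * (real n - 1))"
proof -
  \<comment> \<open>The index is shifted by 2 because the polygon bounds require
    \<open>m \<ge> 2\<close>.\<close>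
  define x where "x m = pi / (2 * real (Suc (Suc m)))" for m
  define d where "d m = s / cos (x m) - s" for m
  have x: "0 < x m" "x m < pi / 2" for m
    using pi_gt_zero by (auto simp: x_def field_simps intro!: add_pos_nonneg)
  have "(\<lambda>m. (pi / 2) / real (Suc (Suc m))) \<longlonglongrightarrow> 0"
    by (intro LIMSEQ_Suc lim_const_over_n)
  then have "x \<longlonglongrightarrow> 0" by (simp add: x_def[abs_def])
  then have lim: "(\<lambda>m. cos (x m)) \<longlonglongrightarrow> 1" using tendsto_cos by force
  have cosx: "0 < cos (x m)" "cos (x m) < 1" for m
  proof -
    show "0 < cos (x m)" using x by (intro cos_gt_zero)
    have "cos (x m) < cos 0" using x[of m] by (intro cos_monotone_0_pi) auto
    then show "cos (x m) < 1" by simp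
  qed
  have "d \<longlonglongrightarrow> s / 1 - s" unfolding d_def by (intro tendsto_intros lim) simp
  moreover have dpos: "d m > 0" for m using cosx s by (simp add: d_def field_simps)
  ultimately have d: "filterlim d (at_right 0) sequentially"
    by (intro tendsto_imp_filterlim_at_right) auto
  have bound: "measure lebesgue (K + cball 0 (real n * s)) - measure lebesgue K
    \<le> real n * (measure lebesgue (K + cball 0 s + cball 0 (d m)) - measure lebesgue K)
      + pi * s\<^sup>2 / (cos (x m))\<^sup>2 * (real n * (real n - 1))" for m
  proof -
    have "cball 0 (s / cos (x m)) = cball 0 s + (cball 0 (d m) :: (real^2) set)"
      using cball_0_add[of s "d m"] s dpos[of m] by (simp add: d_def)
    then show ?thesis
      using parallel_measure_polygon_bound[OF K s, of "Suc (Suc m)" n] by (simp add: x_def add.assoc)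
  qed
  have "compact (K + cball 0 s)" using K by (intro compact_set_plus compact_cball)
  then have "(\<lambda>m. real n * (measure lebesgue (K + cball 0 s + cball 0 (d m)) - measure lebesgue K)
      + pi * s\<^sup>2 / (cos (x m))\<^sup>2 * (real n * (real n - 1)))
    \<longlonglongrightarrow> real n * (measure lebesgue (K + cball 0 s) - measure lebesgue K)
      + pi * s\<^sup>2 / 1\<^sup>2 * (real n * (real n - 1))"
    by (intro tendsto_intros filterlim_compose[OF tendsto_measure_parallel d] lim) auto
  then have "measure lebesgue (K + cball 0 (real n * s)) - measure lebesgue K
    \<le> real n * (measure lebesgue (K + cball 0 s) - measure lebesgue K)
      + pi * s\<^sup>2 / 1\<^sup>2 * (real n * (real n - 1))"
    by (rule LIMSEQ_le_const) (use bound in blast)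
  then show ?thesis by simp
qed

section \<open>From areas of parallel sets to the outer Minkowski content\<close>

lemma parallel_set_eq_set_plus:
  assumes "compact K" "K \<noteq> {}"
  shows "parallel_set K r = K + cball 0 r"
proof -
  have "infdist x K \<le> r \<longleftrightarrow> (\<exists>k\<in>K. dist x k \<le> r)" for x
  proof
    assume "infdist x K \<le> r"
    moreover obtain k where "k \<in> K" "infdist x K = dist x k"
      using infdist_attains_inf[OF compact_imp_closed[OF assms(1)] assms(2)] .
    ultimately show "\<exists>k\<in>K. dist x k \<le> r" by auto
  qed (auto intro: infdist_le2)
  then show ?thesis unfolding parallel_set_def set_plus_cball by (auto simp: dist_commute)
qed

lemma outer_minkowski_quotient_eq:
  assumes "compact K" "K \<noteq> {}" "r > 0"
  shows "outer_minkowski_quotient K r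
    = ereal ((measure lebesgue (K + cball 0 r) - measure lebesgue K) / r)"
proof -
  have c: "compact (K + cball 0 r)" by (intro compact_set_plus assms compact_cball)
  have sub: "K \<subseteq> K + cball 0 r" using assms(3) unfolding set_plus_cball by force
  have "K + cball 0 r - K \<in> lmeasurable"
    using lmeasurable_compact[OF c] lmeasurable_compact[OF assms(1)] by (intro fmeasurable_Diff) auto
  moreover have "measure lebesgue (K + cball 0 r - K) = measure lebesgue (K + cball 0 r) - measure lebesgue K"
    using lmeasurable_compact[OF c] lmeasurable_compact[OF assms(1)] sub by (intro measurable_measure_Diff) auto
  ultimately have "enn2ereal (emeasure lebesgue (K + cball 0 r - K))
      = ereal (measure lebesgue (K + cball 0 r) - measure lebesgue K)"
    by (metis emeasure_eq_measure2 enn2ereal_ennreal measure_nonneg)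
  then show ?thesis
    unfolding outer_minkowski_quotient_def parallel_set_eq_set_plus[OF assms(1,2)]
    using assms(3) by simp
qed

theorem lemma2p2:
  fixes K :: "(real^2) set"
  assumes "continuum K"
  shows "outer_minkowski_content_exists K \<and>
    outer_minkowski_content K =
      (SUP \<epsilon>\<in>{0<..}. outer_minkowski_quotient K \<epsilon> - ereal (pi * \<epsilon>))"
proof -
  have K: "compact K" "connected K" "K \<noteq> {}" using assms by (auto simp: continuum_def)
  define V where "V r = measure lebesgue (K + cball 0 r) - measure lebesgue K" for r
  define sup where "sup = (SUP \<epsilon>\<in>{0<..}. outer_minkowski_quotient K \<epsilon> - ereal (pi * \<epsilon>))"
  let ?q = "outer_minkowski_quotient K"
  have q: "?q r = ereal (V r / r)" if "r > 0" for r
    using outer_minkowski_quotient_eq[OF K(1,3) that] by (simp add: V_def)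
  have pos: "\<forall>\<^sub>F s in at_right 0. s > (0::real)" by (rule eventually_at_right_less)
  have V_mono: "V r \<le> V t" if "r \<le> t" for r t
  proof -
    have "compact (K + cball 0 t)" "K + cball 0 r \<in> sets lebesgue"
      using K lmeasurable_compact[OF compact_set_plus[OF K(1) compact_cball]]
      by (auto intro: compact_set_plus)
    moreover have "K + cball 0 r \<subseteq> K + cball 0 t" using that by (intro set_plus_mono2) auto
    ultimately have "measure lebesgue (K + cball 0 r) \<le> measure lebesgue (K + cball 0 t)"
      by (intro measure_mono_compact)
    then show ?thesis by (simp add: V_def)
  qed
  have V_nonneg: "0 \<le> V r" if "r > 0" for r
    using V_mono[of 0 r] that by (simp add: V_def)
  \<comment> \<open>With \<open>n\<close> the ceiling of \<open>r / s\<close>, the multiple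
    \<open>n * s\<close> lies between \<open>r\<close> and \<open>r + s\<close>. Monotonicity of
    \<open>V\<close> replaces it by \<open>r\<close> in the numerator, and \<open>r + s\<close>
    bounds the denominator.\<close>
  have lower: "V r / (r + s) - pi * r \<le> V s / s" if r: "r > 0" and s: "s > 0" for r s
  proof -
    define n where "n = nat \<lceil>r / s\<rceil>"
    have "0 < r / s" using r s by simp
    then have n: "real n = of_int \<lceil>r / s\<rceil>" by (simp add: n_def)
    have "r / s \<le> real n" "real n < r / s + 1" unfolding n by linarith+
    then have ns: "r \<le> real n * s" "real n * s < r + s" using s by (auto simp: field_simps)
    then have ns0: "real n * s > 0" using r by linarith
    have "V r / (r + s) \<le> V (real n * s) / (real n * s)"
      using V_mono[OF ns(1)] V_nonneg[OF r] ns ns0 r s by (intro frac_le) auto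
    also have "\<dots> \<le> (real n * V s + pi * s\<^sup>2 * (real n * (real n - 1))) / (real n * s)"
      using parallel_measure_multiple_bound[OF K(1,2) s, of n] ns0
      by (intro divide_right_mono) (auto simp: V_def)
    \<comment> \<open>Dividing the quadratic term by \<open>n * s\<close> leaves
      \<open>pi * (n * s - s)\<close>, which is at most \<open>pi * r\<close> by the choice of
      \<open>n\<close>.\<close>
    also have "\<dots> = V s / s + pi * (real n * s - s)"
    proof -
      have "real n * V s + pi * s\<^sup>2 * (real n * (real n - 1)) = (V s / s + pi * (real n * s - s)) * (real n * s)"
        using s by (simp add: field_simps power2_eq_square)
      then show ?thesis using ns0 by (metis less_irrefl nonzero_mult_div_cancel_right)
    qed
    also have "\<dots> \<le> V s / s + pi * r"
      using ns by (intro add_left_mono mult_left_mono) auto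
    finally show ?thesis by linarith
  qed
  have "sup \<le> Liminf (at_right 0) ?q"
    unfolding sup_def
  proof (rule SUP_least)
    fix r :: real assume "r \<in> {0<..}"
    then have r: "r > 0" by simp
    \<comment> \<open>Fix \<open>r\<close> and let \<open>s\<close> tend to 0 in
      \<open>lower\<close>; the left side tends to the term of the supremum at
      \<open>r\<close>.\<close>
    have "((\<lambda>s. V r / (r + s) - pi * r) \<longlongrightarrow> V r / (r + 0) - pi * r) (at_right 0)"
      using r by (intro tendsto_intros) auto
    then have "Liminf (at_right 0) (\<lambda>s. ereal (V r / (r + s) - pi * r)) = ereal (V r / r - pi * r)"
      by (intro lim_imp_Liminf) auto
    moreover have "Liminf (at_right 0) (\<lambda>s. ereal (V r / (r + s) - pi * r)) \<le> Liminf (at_right 0) ?q"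
      using pos by (intro Liminf_mono) (auto elim!: eventually_mono simp: q lower[OF r])
    ultimately show "?q r - ereal (pi * r) \<le> Liminf (at_right 0) ?q" by (simp add: q r)
  qed
  moreover have "Limsup (at_right 0) ?q \<le> sup"
  proof -
    \<comment> \<open>Each quotient is at most the supremum plus its own correction
      \<open>pi * s\<close>, which vanishes in the limit. The supremum is handled as a possibly
      infinite value; adding a finite correction is always harmless.\<close>
    have upper: "?q s \<le> sup + ereal (pi * s)" if s: "s > 0" for s
    proof -
      have "ereal (V s / s - pi * s) \<le> sup"
        unfolding sup_def using s by (intro SUP_upper2[of s]) (auto simp: q)
      then have "ereal (V s / s - pi * s) + ereal (pi * s) \<le> sup + ereal (pi * s)"
        by (rule add_right_mono)
      then show ?thesis using s by (simp add: q)
    qed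
    have "((\<lambda>s. ereal (pi * s)) \<longlongrightarrow> ereal (pi * 0)) (at_right 0)" by (intro tendsto_intros)
    then have "((\<lambda>s. sup + ereal (pi * s)) \<longlongrightarrow> sup + ereal (pi * 0)) (at_right 0)"
      by (intro tendsto_add_ereal_general tendsto_const) auto
    then have "Limsup (at_right 0) (\<lambda>s. sup + ereal (pi * s)) = sup"
      by (intro lim_imp_Limsup) (auto simp: zero_ereal_def[symmetric])
    moreover have "Limsup (at_right 0) ?q \<le> Limsup (at_right 0) (\<lambda>s. sup + ereal (pi * s))"
      using pos by (intro Limsup_mono) (auto elim!: eventually_mono simp: upper)
    ultimately show ?thesis by simp
  qed
  moreover have "Liminf (at_right 0) ?q \<le> Limsup (at_right 0) ?q"
    by (intro Liminf_le_Limsup) simp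
  ultimately have "Liminf (at_right 0) ?q = sup" "Limsup (at_right 0) ?q = sup" by auto
  then have "lower_outer_minkowski_content K = sup" "upper_outer_minkowski_content K = sup"
    by (simp_all add: lower_outer_minkowski_content_def upper_outer_minkowski_content_def)
  then show ?thesis
    by (simp add: outer_minkowski_content_exists_def outer_minkowski_content_def flip: sup_def)
qed

end
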